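(* Let $V=\{\mathbf v_1,\ldots,\mathbf v_k\}\subset S^{d-1}$ be a set of $k$ linearly independent unit vectors in $\mathbb R^d$ and let $\Delta$ be the volume of the parallelepiped generated by $V$. Let $b\ge0$ be a fixed integer and let $a$ be an integer tending to infinity. Let $\mathcal R$ consist of $a+b$ independent random vectors in $\mathbb R^d$ whose $d$ components are i.i.d. $\mathcal N(0,1)$, and let $H=H_{\mathcal R,a,b}$ be the corresponding random projection hash. Then $$\mathbb P\big(H(\mathbf v_1)=\cdots=H(\mathbf v_k)\big)=(1+o(1))\,\Delta^{-b}\binom{a+b}{b}^{-k+1}$$ as $a\to\infty$.
   Context: Random projection hash: for $\mathcal R=\{\mathbf r_1,\ldots,\mathbf r_h\}\subset\mathbb R^d$ and $a+b=h$, $H_{\mathcal R,a,b}(\mathbf v)$ is the set $A\subset\{1,\ldots,h\}$ of size $a$ such that $|\mathbf r_i\cdot\mathbf v|\ge|\mathbf r_j\cdot\mathbf v|$ for all $i\in A$, $j\notin A$ (ties broken by least index); a collision means equality of these sets, and the probability is over $\mathcal R$. *)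

theory Defs
  imports "HOL-Probability.Probability" "HOL-Library.Landau_Symbols"
begin

text \<open>
  Index \<open>i\<close> is ranked before index \<open>j\<close> by \<open>v\<close> if its projection is larger in absolute value,
  or if there is a tie and \<open>i\<close> is the smaller index.
\<close>

definition projection_before :: "(nat \<Rightarrow> 'a::real_inner) \<Rightarrow> 'a \<Rightarrow> nat \<Rightarrow> nat \<Rightarrow> bool" where
  "projection_before r v i j \<longleftrightarrow>
     \<bar>r i \<bullet> v\<bar> > \<bar>r j \<bullet> v\<bar> \<or> (\<bar>r i \<bullet> v\<bar> = \<bar>r j \<bullet> v\<bar> \<and> i < j)"

definition random_projection_hash :: "nat \<Rightarrow> nat \<Rightarrow> (nat \<Rightarrow> 'a::real_inner) \<Rightarrow> 'a \<Rightarrow> nat set" where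
  "random_projection_hash a b r v =
     (THE A. A \<subseteq> {1..a + b} \<and> card A = a \<and>
             (\<forall>i\<in>A. \<forall>j\<in>{1..a + b} - A. projection_before r v i j))"

lemma ex1_random_projection_hash:
  "\<exists>!A. A \<subseteq> {1..a + b} \<and> card A = a \<and>
        (\<forall>i\<in>A. \<forall>j\<in>{1..a + b} - A. projection_before r v i j)"
proof -
  have total: "i = j \<or> projection_before r v i j \<or> projection_before r v j i" for i j
    unfolding projection_before_def by linarith
  have asym: "\<not> (projection_before r v i j \<and> projection_before r v j i)" for i j
    unfolding projection_before_def by linarith
  have trans: "projection_before r v i k"
    if "projection_before r v i j" "projection_before r v j k" for i j k
    using that unfolding projection_before_def by linarith
  have first: "\<exists>x\<in>S. \<forall>y\<in>S - {x}. projection_before r v x y"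
    if "finite S" "S \<noteq> {}" for S
    using that
  proof (induction rule: finite_ne_induct)
    case (insert x F)
    then obtain z where z: "z \<in> F" "\<forall>y\<in>F - {z}. projection_before r v z y"
      by blast
    show ?case
    proof (cases "projection_before r v x z")
      case True
      then have "\<forall>y\<in>insert x F - {x}. projection_before r v x y"
        using z trans by blast
      then show ?thesis
        by blast
    next
      case False
      then have "\<forall>y\<in>insert x F - {z}. projection_before r v z y"
        using z insert.hyps total[of x z] by auto
      then show ?thesis
        using z by blast
    qed
  qed auto
  have ex: "\<exists>A. A \<subseteq> {1..a + b} \<and> card A = n \<and>
               (\<forall>i\<in>A. \<forall>j\<in>{1..a + b} - A. projection_before r v i j)" if "n \<le> a + b" for n
    using that
  proof (induction n)
    case (Suc n)
    then obtain A where A: "A \<subseteq> {1..a + b}" "card A = n"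
        "\<forall>i\<in>A. \<forall>j\<in>{1..a + b} - A. projection_before r v i j"
      by auto
    have "finite A"
      using A(1) by (rule finite_subset) simp
    have "{1..a + b} - A \<noteq> {}"
      using A Suc.prems \<open>finite A\<close> by (metis Diff_eq_empty_iff Suc_n_not_le_n card_atLeastAtMost
          card_mono diff_Suc_1 le_trans)
    then obtain x where "x \<in> {1..a + b} - A"
        "\<forall>y\<in>{1..a + b} - A - {x}. projection_before r v x y"
      using first[of "{1..a + b} - A"] by blast
    then show ?case
      using A \<open>finite A\<close> by (intro exI[of _ "insert x A"]) auto
  qed auto
  have uniq: "A = B"
    if A: "A \<subseteq> {1..a + b}" "card A = a"
        "\<forall>i\<in>A. \<forall>j\<in>{1..a + b} - A. projection_before r v i j"
      and B: "B \<subseteq> {1..a + b}" "card B = a"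
        "\<forall>i\<in>B. \<forall>j\<in>{1..a + b} - B. projection_before r v i j" for A B
  proof (rule ccontr)
    assume "A \<noteq> B"
    have fin: "finite A" "finite B"
      using A(1) B(1) finite_subset by blast+
    then have "\<not> A \<subseteq> B" "\<not> B \<subseteq> A"
      using \<open>A \<noteq> B\<close> A(2) B(2) card_subset_eq by metis+
    then obtain x y where "x \<in> A - B" "y \<in> B - A"
      by blast
    then show False
      using A B asym[of x y] by blast
  qed
  show ?thesis
    using ex[of a] uniq by (intro ex_ex1I) auto
qed

definition parallelepiped :: "('k::finite \<Rightarrow> 'a::real_vector) \<Rightarrow> 'a set" where
  "parallelepiped v = {\<Sum>i\<in>UNIV. t i *\<^sub>R v i | t. \<forall>i. 0 \<le> t i \<and> t i \<le> 1}"

text \<open>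
  The parallelepiped generated by \<open>k\<close> vectors is measured by \<open>k\<close>-dimensional Lebesgue measure,
  which is carried over to the span of the vectors by a linear isometry defined on \<open>\<real>\<^sup>k\<close>.
  By the rotation invariance of Lebesgue measure the result does not depend on the isometry.
\<close>

definition spanning_isometry ::
    "('k::finite \<Rightarrow> 'a::euclidean_space) \<Rightarrow> (real ^ 'k \<Rightarrow> 'a) \<Rightarrow> bool" where
  "spanning_isometry v T \<longleftrightarrow> linear T \<and> (\<forall>x. norm (T x) = norm x) \<and> range T = span (range v)"

definition parallelepiped_volume :: "('k::finite \<Rightarrow> 'a::euclidean_space) \<Rightarrow> real" where
  "parallelepiped_volume v =
     measure lebesgue ((SOME T :: real ^ 'k \<Rightarrow> 'a. spanning_isometry v T) -` parallelepiped v)"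

lemma ex_spanning_isometry:
  fixes v :: "'k::finite \<Rightarrow> 'a::euclidean_space"
  assumes "inj v" "independent (range v)"
  shows "\<exists>T. spanning_isometry v T"
proof -
  have "dim (UNIV :: (real ^ 'k) set) = dim (span (range v))"
    using assms by (simp add: dim_eq_card_independent card_image)
  then obtain T :: "real ^ 'k \<Rightarrow> 'a" and g where
    "linear T" "T ` UNIV = span (range v)" "\<And>x. norm (T x) = norm x"
    by (rule isometries_subspaces[OF subspace_UNIV subspace_span]) auto
  then show ?thesis
    unfolding spanning_isometry_def by blast
qed

end

theory Submission
  imports Defs
begin

text \<open>
  By exchangeability the collision probability is \<open>binom (a + b) b\<close> times the probability that, for
  every \<open>v i\<close>, the projections of \<open>b\<close> fixed vectors are smaller than the least projection \<open>m i\<close> of the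
  other \<open>a\<close>. Conditionally on \<open>m\<close> this has probability \<open>F(m)^b\<close>, where
  \<open>F(t) = P(\<forall>i. |r \<bullet> v i| < t i)\<close> is asymptotic to \<open>c^k / \<Delta> * (\<Prod>i. t i)\<close> near 0, with
  \<open>c = 2 / sqrt (2 * pi)\<close>. The moments of \<open>m\<close> come from the layer-cake formula
  \<open>E (\<Prod>i. m i ^ p i) = \<integral> (\<Prod>i. p i * t i ^ (p i - 1)) * G(t)^a dt\<close> with
  \<open>G(t) = P(\<forall>i. |r \<bullet> v i| > t i)\<close>. After scaling \<open>t\<close> by \<open>1/a\<close>, \<open>G^a\<close> tends to \<open>exp (- c * (\<Sum>i. t i))\<close>:
  at first order in \<open>t\<close> the \<open>v i\<close> do not interact, so \<open>\<Delta>\<close> enters only through \<open>F\<close>.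
\<close>

section \<open>Analytic preliminaries\<close>

text \<open>The constants combine as follows. Write \<open>k\<close> for the number of vectors and
  \<open>K = c^k / \<Delta>\<close>. The moments make the expectation of \<open>F(m)^b\<close>
  asymptotic to \<open>K^b * (fact b / c^b)^k * a^(-k*b)\<close>, and \<open>binom (a + b) b\<close>
  is asymptotic to \<open>a^b / fact b\<close>; the \<open>k\<close>-th power of the latter times
  the former tends to \<open>(K / c^k)^b\<close>, which is \<open>\<Delta>^(-b)\<close>. An
  equivalence of \<open>F\<close> near 0 alone would leave large values of \<open>m\<close> to be
  controlled. Hence \<open>F\<close> is bounded globally: above by its leading term, since the
  Gaussian density is largest at 0, and below by the leading term times
  \<open>1 - C * (\<Sum>i. (t i)^2)\<close>. In the power \<open>b\<close> this correction produces
  moments of total degree \<open>k*b + 2\<close>, which are smaller by a factor of order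
  \<open>a^(-2)\<close>. The scaled integrals converge by domination. As \<open>G\<close> is raised
  to the power \<open>a\<close>, its exponential bound must have prefactor exactly 1. Linear
  independence gives the finite joint density \<open>K\<close>, and, applied to two vectors, shows
  that two projections are both at most \<open>t\<close> with probability \<open>O(t^2)\<close>;
  this is why the vectors do not interact at first order.\<close>

lemma power_one_minus_tendsto_exp:
  fixes u :: "nat \<Rightarrow> real"
  assumes lim: "(\<lambda>n. real n * u n) \<longlonglongrightarrow> x" and u: "\<And>n. 0 \<le> u n" "\<And>n. u n \<le> 1"
  shows "(\<lambda>n. (1 - u n) ^ n) \<longlonglongrightarrow> exp (- x)"
proof -
  have x0: "0 \<le> x"
    using lim by (rule LIMSEQ_le_const) (use u in auto)
  \<comment> \<open>On the interval from -1 to 1 the \<open>n\<close>-th power is Lipschitz with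
    constant \<open>n\<close> (\<open>norm_power_diff\<close>), so replacing \<open>u n\<close> by
    \<open>x / n\<close> costs at most \<open>|n * u n - x|\<close>. For \<open>x \<le> n\<close>
    the second base stays in that interval.\<close>
  have "(\<lambda>n. (1 - u n) ^ n - (1 + (- x) / real n) ^ n) \<longlonglongrightarrow> 0"
  proof (rule Lim_null_comparison)
    show "\<forall>\<^sub>F n in sequentially.
        norm ((1 - u n) ^ n - (1 + (- x) / real n) ^ n) \<le> \<bar>real n * u n - x\<bar>"
      using eventually_gt_at_top[of "nat \<lceil>x\<rceil>"]
    proof eventually_elim
      case (elim n)
      then have n: "0 < n" "x \<le> real n"
        using real_nat_ceiling_ge[of x] by linarith+
      have "norm ((1 - u n) ^ n - (1 + (- x) / real n) ^ n)
          \<le> real n * norm ((1 - u n) - (1 + (- x) / real n))"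
        using n x0 u[of n] by (intro norm_power_diff) (auto simp: abs_le_iff divide_le_eq)
      also have "\<dots> = \<bar>real n * u n - x\<bar>"
      proof -
        have "(1 - u n) - (1 + (- x) / real n) = - (real n * u n - x) / real n"
          using n by (simp add: field_simps)
        then show ?thesis
          using n by (simp only: real_norm_def abs_divide abs_minus_cancel) simp
      qed
      finally show ?case .
    qed
    show "(\<lambda>n. \<bar>real n * u n - x\<bar>) \<longlonglongrightarrow> 0"
      using lim by (simp add: tendsto_rabs_zero LIM_zero)
  qed
  from tendsto_add[OF this tendsto_exp_limit_sequentially[of "- x"]] show ?thesis by simp
qed

lemma nn_integral_lborel_vec_prod:
  fixes f :: "'k::finite \<Rightarrow> real \<Rightarrow> ennreal"
  assumes [measurable]: "\<And>i. f i \<in> borel_measurable borel"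
  shows "(\<integral>\<^sup>+t. (\<Prod>i\<in>UNIV. f i (t $ i)) \<partial>(lborel :: (real ^ 'k) measure)) = (\<Prod>i\<in>UNIV. \<integral>\<^sup>+s. f i s \<partial>lborel)"
proof -
  have B: "(Basis :: (real ^ 'k) set) = (\<lambda>i. axis i 1) ` UNIV"
    by (auto simp: Basis_vec_def)
  have inj: "inj (\<lambda>i::'k. axis i (1::real))"
    by (auto simp: inj_on_def axis_eq_axis)
  have "(\<integral>\<^sup>+t. (\<Prod>b\<in>Basis. f (axis_index b) (t \<bullet> b)) \<partial>(lborel :: (real ^ 'k) measure))
      = (\<Prod>b\<in>(Basis :: (real ^ 'k) set). \<integral>\<^sup>+s. f (axis_index b) s \<partial>lborel)"
    by (rule nn_integral_lborel_prod) auto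
  then show ?thesis
    unfolding B by (simp add: prod.reindex[OF inj] axis_index_axis inner_axis)
qed

lemma nn_integral_lborel_scale:
  fixes f :: "'a::euclidean_space \<Rightarrow> ennreal"
  assumes [measurable]: "f \<in> borel_measurable borel" and "\<alpha> \<noteq> 0"
  shows "(\<integral>\<^sup>+t. f t \<partial>lborel) = ennreal (\<bar>\<alpha>\<bar> ^ DIM('a)) * (\<integral>\<^sup>+s. f (\<alpha> *\<^sub>R s) \<partial>lborel)"
  using assms(2) by (subst lborel_affine[of \<alpha> 0])
    (simp_all add: nn_integral_density nn_integral_distr nn_integral_cmult)

text \<open>The strict bound \<open>t < m\<close> is the form that \<open>less_least_iff\<close>
  splits into one condition per vector. Since \<open>p\<close> is positive, the antiderivative
  \<open>t ^ p\<close> vanishes at 0.\<close>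

lemma nn_integral_power_layer:
  assumes "0 \<le> m" "0 < p"
  shows "(\<integral>\<^sup>+t. (if 0 < t \<and> t < m then ennreal (real p * t ^ (p - 1)) else 0) \<partial>lborel) = ennreal (m ^ p)"
proof -
  have "AE t in lborel. t \<noteq> 0 \<and> t \<noteq> m"
    by (intro AE_conjI AE_lborel_singleton)
  then have "(\<integral>\<^sup>+t. (if 0 < t \<and> t < m then ennreal (real p * t ^ (p - 1)) else 0) \<partial>lborel)
      = (\<integral>\<^sup>+t. ennreal (real p * t ^ (p - 1)) * indicator {0..m} t \<partial>lborel)"
    by (intro nn_integral_cong_AE) (erule eventually_mono, auto simp: indicator_def)
  also have "\<dots> = ennreal (m ^ p - 0 ^ p)"
    using assms by (intro nn_integral_FTC_Icc) (auto intro!: derivative_eq_intros)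
  finally show ?thesis
    using assms by simp
qed

text \<open>This is \<open>p\<close> times the Gamma integral \<open>fact (p - 1)\<close>, after the
  substitution of \<open>t / c\<close> for \<open>t\<close>.\<close>

lemma nn_integral_power_exp:
  assumes "0 < c" "0 < p"
  shows "(\<integral>\<^sup>+t. (if 0 < t then ennreal (real p * t ^ (p - 1) * exp (- c * t)) else 0) \<partial>lborel)
    = ennreal (fact p / c ^ p)"
proof -
  have "(\<integral>\<^sup>+t. (if 0 < t then ennreal (real p * t ^ (p - 1) * exp (- c * t)) else 0) \<partial>lborel)
      = ennreal (1 / c) * (\<integral>\<^sup>+t. (if 0 < t then ennreal (real p * (t / c) ^ (p - 1) * exp (- t)) else 0) \<partial>lborel)"
    using assms by (subst nn_integral_lborel_scale[where \<alpha> = "1 / c"])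
      (auto intro!: arg_cong2[where f = times] nn_integral_cong simp: field_simps)
  also have "(\<integral>\<^sup>+t. (if 0 < t then ennreal (real p * (t / c) ^ (p - 1) * exp (- t)) else 0) \<partial>lborel)
      = (\<integral>\<^sup>+t. ennreal (real p / c ^ (p - 1)) * (ennreal (t ^ (p - 1) * exp (- t)) * indicator {0..} t) \<partial>lborel)"
    using assms AE_lborel_singleton[of "0::real"]
    by (intro nn_integral_cong_AE)
      (auto elim!: eventually_mono simp: indicator_def power_divide ennreal_mult[symmetric] field_simps)
  also have "\<dots> = ennreal (real p / c ^ (p - 1)) * ennreal (fact (p - 1))"
    by (subst nn_integral_cmult) (auto simp: nn_intergal_power_times_exp_Ici)
  also have "ennreal (1 / c) * \<dots> = ennreal (fact p / c ^ p)"
    using assms by (cases p) (auto simp: ennreal_mult[symmetric] field_simps)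
  finally show ?thesis .
qed

lemma binomial_add_tendsto:
  "(\<lambda>a. real ((a + b) choose b) / real a ^ b) \<longlonglongrightarrow> 1 / fact b"
proof (induction b)
  case 0
  then show ?case by simp
next
  case (Suc b)
  have "(\<lambda>a. (1 + (real b + 1) / real a) / real (Suc b)) \<longlonglongrightarrow> (1 + 0) / real (Suc b)"
    by (intro tendsto_intros lim_const_over_n) auto
  then have "(\<lambda>a. (real a + real b + 1) / (real a * real (Suc b))) \<longlonglongrightarrow> 1 / real (Suc b)"
  proof (rule Lim_transform_eventually[OF _ eventually_mono[OF eventually_gt_at_top[of 0]], THEN tendsto_eq_rhs])
    show "(1 + (real b + 1) / real a) / real (Suc b) = (real a + real b + 1) / (real a * real (Suc b))"
      if "0 < a" for a
      using that by (simp add: field_simps)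
  qed simp
  from tendsto_mult[OF Suc.IH this] 
  have "(\<lambda>a. real ((a + b) choose b) / real a ^ b * ((real a + real b + 1) / (real a * real (Suc b)))) \<longlonglongrightarrow> 1 / fact (Suc b)"
    by (simp add: field_simps del: of_nat_Suc)
  then show ?case
  proof (rule Lim_transform_eventually)
    show "\<forall>\<^sub>F a in sequentially. real ((a + b) choose b) / real a ^ b * ((real a + real b + 1) / (real a * real (Suc b)))
       = real ((a + Suc b) choose Suc b) / real a ^ Suc b"
      using eventually_gt_at_top[of 0]
    proof eventually_elim
      case (elim a)
      have "real (Suc b) * real ((a + Suc b) choose Suc b) = real (Suc (a + b)) * real ((a + b) choose b)"
        using Suc_times_binomial_eq[of "a + b" b] by (metis add_Suc_right mult.commute of_nat_mult)
      then have "real ((a + Suc b) choose Suc b) = real (Suc (a + b)) * real ((a + b) choose b) / real (Suc b)"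
        by (metis nonzero_mult_div_cancel_left of_nat_eq_0_iff old.nat.distinct(2))
      then show ?case by (simp add: ac_simps)
    qed
  qed
qed

section \<open>Characterization of the hash set\<close>

lemma random_projection_hash_spec:
  "random_projection_hash a b r v \<subseteq> {1..a + b}"
  "card (random_projection_hash a b r v) = a"
  "n \<in> random_projection_hash a b r v \<Longrightarrow> m \<in> {1..a + b} - random_projection_hash a b r v \<Longrightarrow>
     projection_before r v n m"
  using theI'[OF ex1_random_projection_hash[of a b r v]] unfolding random_projection_hash_def by blast+

lemma random_projection_hash_eqI:
  assumes "A \<subseteq> {1..a + b}" "card A = a"
    and "\<And>n m. n \<in> A \<Longrightarrow> m \<in> {1..a + b} - A \<Longrightarrow> projection_before r v n m"
  shows "random_projection_hash a b r v = A"
  unfolding random_projection_hash_def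
  using assms by (intro the1_equality ex1_random_projection_hash) auto

text \<open>The two families may live in different spaces. This is what permits the passage from
  random vectors and \<open>v i\<close> in dimension \<open>d\<close> to projection vectors and
  \<open>axis i 1\<close> in dimension \<open>k\<close>.\<close>

lemma random_projection_hash_cong:
  assumes "\<And>n. n \<in> {1..a + b} \<Longrightarrow> x n \<bullet> e = r n \<bullet> u"
  shows "random_projection_hash a b x e = random_projection_hash a b r u"
proof (rule random_projection_hash_eqI)
  let ?A = "random_projection_hash a b r u"
  show "?A \<subseteq> {1..a + b}" "card ?A = a"
    by (rule random_projection_hash_spec)+
  show "projection_before x e n m" if "n \<in> ?A" "m \<in> {1..a + b} - ?A" for n m
  proof -
    have "n \<in> {1..a + b}" "m \<in> {1..a + b}"
      using that random_projection_hash_spec(1)[of a b r u] by blast+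
    then show ?thesis
      using random_projection_hash_spec(3)[OF that] by (simp only: projection_before_def assms)
  qed
qed

section \<open>Collisions under an abstract law of the projections\<close>

lemma measurable_vec_nth_comp [measurable (raw)]:
  fixes f :: "'a \<Rightarrow> real ^ 'n"
  shows "f \<in> borel_measurable M \<Longrightarrow> (\<lambda>x. f x $ i) \<in> borel_measurable M"
  by (rule measurable_compose[where N = borel]) auto

text \<open>
  \<open>N\<close> is the law of the vector of projections \<open>r \<bullet> v i\<close>; \<open>c\<close> is the density of \<open>|r \<bullet> v i|\<close> at 0
  and \<open>K\<close> is the joint density of all \<open>|r \<bullet> v i|\<close> at 0.
\<close>

locale projection_law = prob_space N for N :: "(real ^ 'k::finite) measure" +
  fixes c \<kappa> K C :: real
  assumes sets_N [measurable_cong]: "sets N = sets borel"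
    and c_pos: "0 < c" and \<kappa>_pos: "0 < \<kappa>" and K_pos: "0 < K" and C_nonneg: "0 \<le> C"
    and marginal: "\<And>i. ((\<lambda>t. prob {x. \<bar>x $ i\<bar> \<le> t} / t) \<longlongrightarrow> c) (at_right 0)"
    and pair: "\<And>i j. i \<noteq> j \<Longrightarrow> ((\<lambda>t. prob {x. \<bar>x $ i\<bar> \<le> t \<and> \<bar>x $ j\<bar> \<le> t} / t) \<longlongrightarrow> 0) (at_right 0)"
    and tail: "\<And>i t. 0 \<le> t \<Longrightarrow> prob {x. t < \<bar>x $ i\<bar>} \<le> exp (- \<kappa> * t)"
    and no_atom: "\<And>i t. prob {x. \<bar>x $ i\<bar> = t} = 0"
    and box_upper: "\<And>t. (\<And>i. 0 \<le> t $ i) \<Longrightarrow> prob {x. \<forall>i. \<bar>x $ i\<bar> < t $ i} \<le> K * (\<Prod>i\<in>UNIV. t $ i)"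
    and box_lower: "\<And>t. (\<And>i. 0 \<le> t $ i) \<Longrightarrow>
      K * (\<Prod>i\<in>UNIV. t $ i) * (1 - C * (\<Sum>i\<in>UNIV. (t $ i)\<^sup>2)) \<le> prob {x. \<forall>i. \<bar>x $ i\<bar> < t $ i}"
begin

section \<open>Joint survival probability near the origin\<close>

lemma space_N [simp]: "space N = UNIV"
  using sets_eq_imp_space_eq[OF sets_N] by simp

lemma Collect_in_N [simp]: "Measurable.pred borel P \<Longrightarrow> {x. P x} \<in> sets N"
  by (simp add: pred_def sets_N)

text \<open>The function \<open>G\<close> of the overview.\<close>

definition surv :: "real ^ 'k \<Rightarrow> real" where
  "surv t = prob {x. \<forall>i. t $ i < \<bar>x $ i\<bar>}"

lemma surv_nonneg: "0 \<le> surv t" and surv_le_1: "surv t \<le> 1"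
  by (simp_all add: surv_def)

text \<open>Written as an integral over \<open>N\<close> with parameter \<open>t\<close>, the
  probability inherits measurability in \<open>t\<close> from the joint predicate by Tonelli's
  theorem.\<close>

lemma measurable_prob_Collect:
  fixes P :: "real ^ 'k \<Rightarrow> real ^ 'k \<Rightarrow> bool"
  assumes [measurable]: "Measurable.pred (borel \<Otimes>\<^sub>M borel) (\<lambda>z. P (fst z) (snd z))"
  shows "(\<lambda>t. prob {x. P t x}) \<in> borel_measurable borel"
proof -
  have "prob {x. P t x} = enn2real (\<integral>\<^sup>+x. (if P t x then 1 else 0) \<partial>N)" for t
  proof -
    have "Measurable.pred borel (\<lambda>x. P (fst (t, x)) (snd (t, x)))"
      by measurable
    then have "{x. P t x} \<in> sets N"
      by (intro Collect_in_N) simp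
    then have "(\<integral>\<^sup>+x. indicator {x. P t x} x \<partial>N) = emeasure N {x. P t x}"
      by (rule nn_integral_indicator)
    then show ?thesis
      by (simp add: measure_def indicator_def of_bool_def)
  qed
  moreover have "(\<lambda>t. enn2real (\<integral>\<^sup>+x. (if P t x then 1 else 0) \<partial>N)) \<in> borel_measurable borel"
  proof -
    have [measurable]: "Measurable.pred (borel \<Otimes>\<^sub>M N) (\<lambda>z. P (fst z) (snd z))"
      by measurable
    show ?thesis
      by measurable
  qed
  ultimately show ?thesis
    by simp
qed

lemma measurable_surv [measurable]: "surv \<in> borel_measurable borel"
  unfolding surv_def[abs_def] by (rule measurable_prob_Collect) measurable

text \<open>The largest component of \<open>t\<close> is at least the mean of the components, and
  the tail bound is applied to it alone. An exponential linear in \<open>t\<close> has the right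
  shape: its \<open>a\<close>-th power at \<open>t / a\<close> does not depend on \<open>a\<close>,
  so it serves as the majorant in \<open>moment_tendsto\<close>.\<close>

lemma surv_bound:
  assumes "\<And>i. 0 \<le> t $ i"
  shows "surv t \<le> exp (- (\<kappa> / CARD('k)) * (\<Sum>i\<in>UNIV. t $ i))"
proof -
  obtain i where i: "t $ i = Max (range (($) t))"
    using Max_in[of "range (($) t)"] by (metis (full_types) finite_class.finite_UNIV finite_imageI image_iff empty_not_UNIV image_is_empty)
  have "surv t \<le> prob {x. t $ i < \<bar>x $ i\<bar>}"
    unfolding surv_def by (intro finite_measure_mono Collect_in_N) auto
  also have "\<dots> \<le> exp (- \<kappa> * t $ i)"
    using assms by (rule tail)
  also have "(\<Sum>i\<in>UNIV. t $ i) \<le> real CARD('k) * t $ i"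
    unfolding i by (intro order_trans[OF sum_bounded_above[of UNIV]]) auto
  then have "exp (- \<kappa> * t $ i) \<le> exp (- (\<kappa> / CARD('k)) * (\<Sum>i\<in>UNIV. t $ i))"
    using \<kappa>_pos by (simp add: field_simps)
  finally show ?thesis .
qed

lemma one_minus_surv_upper: "1 - surv t \<le> (\<Sum>i\<in>UNIV. prob {x. \<bar>x $ i\<bar> \<le> t $ i})"
proof -
  have "1 - surv t = prob (space N - {x. \<forall>i. t $ i < \<bar>x $ i\<bar>})"
    unfolding surv_def by (intro prob_compl[symmetric] Collect_in_N) measurable
  also have "space N - {x. \<forall>i. t $ i < \<bar>x $ i\<bar>} = (\<Union>i\<in>UNIV. {x. \<bar>x $ i\<bar> \<le> t $ i})"
    by (simp add: set_eq_iff not_less)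
  also have "prob \<dots> \<le> (\<Sum>i\<in>UNIV. prob {x. \<bar>x $ i\<bar> \<le> t $ i})"
    by (intro finite_measure_subadditive_finite) auto
  finally show ?thesis .
qed

text \<open>A Bonferroni inequality, with each pair counted in both orders.\<close>

lemma one_minus_surv_lower:
  "(\<Sum>i\<in>UNIV. prob {x. \<bar>x $ i\<bar> \<le> t $ i}) -
     (\<Sum>i\<in>UNIV. \<Sum>j\<in>UNIV - {i}. prob {x. \<bar>x $ i\<bar> \<le> t $ i \<and> \<bar>x $ j\<bar> \<le> t $ j}) \<le> 1 - surv t"
proof -
  define A where "A i = {x :: real ^ 'k. \<bar>x $ i\<bar> \<le> t $ i}" for i
  \<comment> \<open>The points of \<open>A i\<close> that lie in no other of the sets. These parts
    are disjoint and avoid the event of \<open>surv t\<close>, so their probabilities add up to at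
    most \<open>1 - surv t\<close>.\<close>
  define B where "B i = A i - (\<Union>j\<in>UNIV - {i}. A j)" for i
  have A [simp]: "A i \<in> sets N" for i
    unfolding A_def by (intro Collect_in_N) measurable
  have B [simp]: "B i \<in> sets N" for i
    unfolding B_def by (intro sets.Diff sets.finite_UN) auto
  have *: "prob (A i) - (\<Sum>j\<in>UNIV - {i}. prob (A i \<inter> A j)) \<le> prob (B i)" for i
  proof -
    have "prob (A i) \<le> prob (B i \<union> (\<Union>j\<in>UNIV - {i}. A i \<inter> A j))"
      by (intro finite_measure_mono sets.Un sets.finite_UN)
        (auto simp: B_def intro!: sets.Diff sets.finite_UN)
    also have "\<dots> \<le> prob (B i) + prob (\<Union>j\<in>UNIV - {i}. A i \<inter> A j)"
      by (intro measure_Un_le sets.finite_UN) auto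
    also have "prob (\<Union>j\<in>UNIV - {i}. A i \<inter> A j) \<le> (\<Sum>j\<in>UNIV - {i}. prob (A i \<inter> A j))"
      by (intro finite_measure_subadditive_finite) auto
    finally show ?thesis by simp
  qed
  have AA: "{x. \<bar>x $ i\<bar> \<le> t $ i \<and> \<bar>x $ j\<bar> \<le> t $ j} = A i \<inter> A j" for i j
    by (auto simp: A_def)
  have "(\<Sum>i\<in>UNIV. prob (A i)) - (\<Sum>i\<in>UNIV. \<Sum>j\<in>UNIV - {i}. prob (A i \<inter> A j)) \<le> (\<Sum>i\<in>UNIV. prob (B i))"
    unfolding sum_subtractf[symmetric] by (intro sum_mono *)
  also have "\<dots> = prob (\<Union>i\<in>UNIV. B i)"
  proof (rule finite_measure_finite_Union[symmetric])
    show "disjoint_family_on B UNIV"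
      by (auto simp: disjoint_family_on_def B_def)
  qed auto
  also have "\<dots> \<le> prob (space N - {x. \<forall>i. t $ i < \<bar>x $ i\<bar>})"
    by (intro finite_measure_mono sets.compl_sets Collect_in_N)
      (simp_all add: B_def A_def not_less subset_iff, blast)
  also have "\<dots> = 1 - surv t"
    unfolding surv_def by (intro prob_compl Collect_in_N) measurable
  finally show ?thesis
    unfolding AA A_def[symmetric] .
qed

text \<open>Multiplied by \<open>a\<close>, the marginal probabilities tend to
  \<open>c * s $ i\<close> and the pair probabilities to 0, so the union bound and the Bonferroni
  bound squeeze \<open>a * (1 - surv (s /\<^sub>R real a))\<close>.\<close>

lemma surv_power_tendsto:
  assumes s: "\<And>i. 0 < s $ i"
  shows "(\<lambda>a. surv (s /\<^sub>R real a) ^ a) \<longlonglongrightarrow> exp (- c * (\<Sum>i\<in>UNIV. s $ i))"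
proof -
  have at_right: "filterlim (\<lambda>a. r / real a) (at_right 0) sequentially" if "0 < r" for r
  proof (rule tendsto_imp_filterlim_at_right)
    show "(\<lambda>a. r / real a) \<longlonglongrightarrow> 0"
      by (rule lim_const_over_n)
    show "\<forall>\<^sub>F a in sequentially. 0 < r / real a"
      using eventually_gt_at_top[of 0] by eventually_elim (use that in simp)
  qed
  have marg: "(\<lambda>a. real a * prob {x. \<bar>x $ i\<bar> \<le> s $ i / real a}) \<longlonglongrightarrow> c * s $ i" for i
  proof -
    have "(\<lambda>a. prob {x. \<bar>x $ i\<bar> \<le> s $ i / real a} / (s $ i / real a) * s $ i) \<longlonglongrightarrow> c * s $ i"
      by (intro tendsto_mult tendsto_const filterlim_compose[OF marginal at_right[OF s]])
    then show ?thesis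
      by (rule Lim_transform_eventually)
        (use s[of i] in \<open>auto intro!: eventually_mono[OF eventually_gt_at_top[of 0]]\<close>)
  qed
  have pair0: "(\<lambda>a. real a * prob {x. \<bar>x $ i\<bar> \<le> s $ i / real a \<and> \<bar>x $ j\<bar> \<le> s $ j / real a}) \<longlonglongrightarrow> 0"
    if "i \<noteq> j" for i j
  proof -
    \<comment> \<open>The assumption \<open>pair\<close> has one common threshold, so both
      thresholds are raised to the larger one.\<close>
    define r where "r = max (s $ i) (s $ j)"
    have r: "0 < r"
      using s[of i] by (simp add: r_def)
    have "(\<lambda>a. prob {x. \<bar>x $ i\<bar> \<le> r / real a \<and> \<bar>x $ j\<bar> \<le> r / real a} / (r / real a) * r) \<longlonglongrightarrow> 0 * r"
      by (intro tendsto_mult tendsto_const filterlim_compose[OF pair[OF that] at_right[OF r]])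
    then have lim: "(\<lambda>a. real a * prob {x. \<bar>x $ i\<bar> \<le> r / real a \<and> \<bar>x $ j\<bar> \<le> r / real a}) \<longlonglongrightarrow> 0"
      using r by (simp add: mult.commute)
    show ?thesis
    proof (rule tendsto_sandwich[OF always_eventually always_eventually tendsto_const lim])
      show "\<forall>a. real a * prob {x. \<bar>x $ i\<bar> \<le> s $ i / real a \<and> \<bar>x $ j\<bar> \<le> s $ j / real a}
          \<le> real a * prob {x. \<bar>x $ i\<bar> \<le> r / real a \<and> \<bar>x $ j\<bar> \<le> r / real a}"
      proof
        fix a :: nat
        have "s $ i / real a \<le> r / real a" "s $ j / real a \<le> r / real a"
          by (auto simp: r_def divide_right_mono)
        then show "real a * prob {x. \<bar>x $ i\<bar> \<le> s $ i / real a \<and> \<bar>x $ j\<bar> \<le> s $ j / real a}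
          \<le> real a * prob {x. \<bar>x $ i\<bar> \<le> r / real a \<and> \<bar>x $ j\<bar> \<le> r / real a}"
          by (intro mult_left_mono finite_measure_mono Collect_in_N) auto
      qed
    qed simp
  qed
  have "(\<lambda>a. real a * (1 - surv (s /\<^sub>R real a))) \<longlonglongrightarrow> (\<Sum>i\<in>UNIV. c * s $ i)"
  proof (rule tendsto_sandwich[rotated 2])
    have "(\<lambda>a. \<Sum>i\<in>UNIV. \<Sum>j\<in>UNIV - {i}.
        real a * prob {x. \<bar>x $ i\<bar> \<le> s $ i / real a \<and> \<bar>x $ j\<bar> \<le> s $ j / real a}) \<longlonglongrightarrow> 0"
      by (rule tendsto_null_sum, rule tendsto_null_sum, rule pair0) auto
    from tendsto_diff[OF tendsto_sum[OF marg] this]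
    show "(\<lambda>a. (\<Sum>i\<in>UNIV. real a * prob {x. \<bar>x $ i\<bar> \<le> s $ i / real a}) -
        (\<Sum>i\<in>UNIV. \<Sum>j\<in>UNIV - {i}. real a * prob {x. \<bar>x $ i\<bar> \<le> s $ i / real a \<and> \<bar>x $ j\<bar> \<le> s $ j / real a}))
        \<longlonglongrightarrow> (\<Sum>i\<in>UNIV. c * s $ i)"
      by simp
    show "(\<lambda>a. (\<Sum>i\<in>UNIV. real a * prob {x. \<bar>x $ i\<bar> \<le> s $ i / real a})) \<longlonglongrightarrow> (\<Sum>i\<in>UNIV. c * s $ i)"
      by (intro tendsto_sum marg)
    show "\<forall>\<^sub>F a in sequentially. (\<Sum>i\<in>UNIV. real a * prob {x. \<bar>x $ i\<bar> \<le> s $ i / real a}) -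
        (\<Sum>i\<in>UNIV. \<Sum>j\<in>UNIV - {i}. real a * prob {x. \<bar>x $ i\<bar> \<le> s $ i / real a \<and> \<bar>x $ j\<bar> \<le> s $ j / real a})
        \<le> real a * (1 - surv (s /\<^sub>R real a))"
    proof (intro always_eventually allI)
      fix a :: nat
      show "(\<Sum>i\<in>UNIV. real a * prob {x. \<bar>x $ i\<bar> \<le> s $ i / real a}) -
        (\<Sum>i\<in>UNIV. \<Sum>j\<in>UNIV - {i}. real a * prob {x. \<bar>x $ i\<bar> \<le> s $ i / real a \<and> \<bar>x $ j\<bar> \<le> s $ j / real a})
        \<le> real a * (1 - surv (s /\<^sub>R real a))"
        using mult_left_mono[OF one_minus_surv_lower[of "s /\<^sub>R real a"], of "real a"]
        by (simp add: right_diff_distrib sum_distrib_left divide_inverse mult.commute)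
    qed
    show "\<forall>\<^sub>F a in sequentially. real a * (1 - surv (s /\<^sub>R real a))
        \<le> (\<Sum>i\<in>UNIV. real a * prob {x. \<bar>x $ i\<bar> \<le> s $ i / real a})"
    proof (intro always_eventually allI)
      fix a :: nat
      show "real a * (1 - surv (s /\<^sub>R real a)) \<le> (\<Sum>i\<in>UNIV. real a * prob {x. \<bar>x $ i\<bar> \<le> s $ i / real a})"
        using mult_left_mono[OF one_minus_surv_upper[of "s /\<^sub>R real a"], of "real a"]
        by (simp add: sum_distrib_left divide_inverse mult.commute)
    qed
  qed
  then have "(\<lambda>a. (1 - (1 - surv (s /\<^sub>R real a))) ^ a) \<longlonglongrightarrow> exp (- (\<Sum>i\<in>UNIV. c * s $ i))"
    by (rule power_one_minus_tendsto_exp) (use surv_nonneg surv_le_1 in \<open>auto simp: algebra_simps\<close>)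
  then show ?thesis
    by (simp add: sum_distrib_left sum_negf)
qed

section \<open>Moments of the componentwise minima\<close>

definition weight :: "('k \<Rightarrow> nat) \<Rightarrow> real ^ 'k \<Rightarrow> ennreal" where
  "weight p t = (\<Prod>i\<in>UNIV. if 0 < t $ i then ennreal (real (p i) * t $ i ^ (p i - 1)) else 0)"

lemma measurable_weight [measurable]: "weight p \<in> borel_measurable borel"
  unfolding weight_def by measurable

lemma weight_eq_0: "\<not> 0 < t $ i \<Longrightarrow> weight p t = 0"
  unfolding weight_def by (rule prod_zero) auto

lemma nn_integral_weight_exp:
  assumes "\<And>i. 0 < p i" "0 < r"
  shows "(\<integral>\<^sup>+t. weight p t * ennreal (exp (- r * (\<Sum>i\<in>UNIV. t $ i))) \<partial>lborel)
    = ennreal (\<Prod>i\<in>UNIV. fact (p i) / r ^ p i)"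
proof -
  have "weight p t * ennreal (exp (- r * (\<Sum>i\<in>UNIV. t $ i)))
    = (\<Prod>i\<in>UNIV. if 0 < t $ i then ennreal (real (p i) * t $ i ^ (p i - 1) * exp (- r * t $ i)) else 0)" for t
    unfolding weight_def sum_distrib_left
    by (auto simp: exp_sum ennreal_mult prod_ennreal[symmetric] prod.distrib[symmetric] intro!: prod.cong)
  then show ?thesis
    using assms by (simp only: ) (subst nn_integral_lborel_vec_prod; simp add: nn_integral_power_exp prod_ennreal)
qed

text \<open>The vector \<open>m\<close> of the overview, for the vectors with index in
  \<open>I\<close>.\<close>

definition least :: "nat set \<Rightarrow> (nat \<Rightarrow> real ^ 'k) \<Rightarrow> real ^ 'k" where
  "least I x = (\<chi> i. Min ((\<lambda>n. \<bar>x n $ i\<bar>) ` I))"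

lemma less_least_iff: "finite I \<Longrightarrow> I \<noteq> {} \<Longrightarrow> t < least I x $ i \<longleftrightarrow> (\<forall>n\<in>I. t < \<bar>x n $ i\<bar>)"
  by (auto simp: least_def)

lemma least_nonneg: "finite I \<Longrightarrow> I \<noteq> {} \<Longrightarrow> 0 \<le> least I x $ i"
  by (auto simp: least_def)

definition moment :: "nat set \<Rightarrow> ('k \<Rightarrow> nat) \<Rightarrow> ennreal" where
  "moment I p = (\<integral>\<^sup>+x. (\<Prod>i\<in>UNIV. ennreal (least I x $ i ^ p i)) \<partial>PiM I (\<lambda>_. N))"

lemma measurable_least [measurable]:
  "finite I \<Longrightarrow> (\<lambda>x. least I x $ i) \<in> borel_measurable (PiM I (\<lambda>_. N))"
  unfolding least_def vec_lambda_beta by measurable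

text \<open>On the positive orthant \<open>weight p\<close> is the mixed partial derivative of the
  monomial with exponents \<open>p\<close>, so its integral over the box below
  \<open>least I x\<close> is the value of the monomial at \<open>least I x\<close>. After the
  exchange of integrals, the event that \<open>t\<close> lies below the minimum in every component
  factorizes over the independent vectors.\<close>

lemma moment_eq:
  assumes I: "finite I" "I \<noteq> {}" and p: "\<And>i. 0 < p i"
  shows "moment I p = (\<integral>\<^sup>+t. weight p t * ennreal (surv t ^ card I) \<partial>lborel)"
proof -
  interpret P: product_prob_space "\<lambda>_. N" I
    by unfold_locales
  interpret pair_sigma_finite "PiM I (\<lambda>_. N)" "lborel :: (real ^ 'k) measure"
    by unfold_locales
  define A where "A x t \<longleftrightarrow> (\<forall>n\<in>I. \<forall>i. t $ i < \<bar>x n $ i\<bar>)" for x :: "nat \<Rightarrow> real ^ 'k" and t :: "real ^ 'k"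
  have A [measurable]: "Measurable.pred (PiM I (\<lambda>_. N) \<Otimes>\<^sub>M lborel) (\<lambda>z. A (fst z) (snd z))"
    unfolding A_def using I by measurable
  have "(\<Prod>i\<in>UNIV. ennreal (least I x $ i ^ p i)) = (\<integral>\<^sup>+t. weight p t * (if A x t then 1 else 0) \<partial>lborel)" for x
  proof -
    have "(\<Prod>i\<in>UNIV. ennreal (least I x $ i ^ p i))
        = (\<Prod>i\<in>UNIV. \<integral>\<^sup>+s. (if 0 < s \<and> s < least I x $ i then ennreal (real (p i) * s ^ (p i - 1)) else 0) \<partial>lborel)"
      by (intro prod.cong refl nn_integral_power_layer[symmetric] least_nonneg I p)
    also have "\<dots> = (\<integral>\<^sup>+t. (\<Prod>i\<in>UNIV. if 0 < t $ i \<and> t $ i < least I x $ i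
        then ennreal (real (p i) * t $ i ^ (p i - 1)) else 0) \<partial>lborel)"
      by (intro nn_integral_lborel_vec_prod[symmetric]) measurable
    also have "\<dots> = (\<integral>\<^sup>+t. weight p t * (if A x t then 1 else 0) \<partial>lborel)"
    proof (rule nn_integral_cong)
      fix t :: "real ^ 'k"
      show "(\<Prod>i\<in>UNIV. if 0 < t $ i \<and> t $ i < least I x $ i then ennreal (real (p i) * t $ i ^ (p i - 1)) else 0)
          = weight p t * (if A x t then 1 else 0)"
      proof (cases "\<forall>i. t $ i < least I x $ i")
        case True
        then show ?thesis
          using I by (auto simp: weight_def A_def less_least_iff)
      next
        case False
        then have "\<not> A x t"
          using I by (auto simp: A_def less_least_iff)
        with False show ?thesis
          by (auto intro!: prod_zero)
      qed
    qed
    finally show ?thesis .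
  qed
  then have "moment I p = (\<integral>\<^sup>+x. \<integral>\<^sup>+t. weight p t * (if A x t then 1 else 0) \<partial>lborel \<partial>PiM I (\<lambda>_. N))"
    by (simp add: moment_def)
  also have "\<dots> = (\<integral>\<^sup>+t. \<integral>\<^sup>+x. weight p t * (if A x t then 1 else 0) \<partial>PiM I (\<lambda>_. N) \<partial>lborel)"
  proof (rule Fubini'[symmetric])
    have "(\<lambda>z. weight p (snd z) * (if A (fst z) (snd z) then 1 else 0))
      \<in> borel_measurable (PiM I (\<lambda>_. N) \<Otimes>\<^sub>M lborel)"
      by measurable
    then show "(\<lambda>(x, t). weight p t * (if A x t then 1 else 0)) \<in> borel_measurable (PiM I (\<lambda>_. N) \<Otimes>\<^sub>M lborel)"
      by (simp add: case_prod_beta')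
  qed
  also have "\<dots> = (\<integral>\<^sup>+t. weight p t * ennreal (surv t ^ card I) \<partial>lborel)"
  proof (rule nn_integral_cong)
    fix t :: "real ^ 'k"
    let ?S = "{x. \<forall>i. t $ i < \<bar>x $ i\<bar>} :: (real ^ 'k) set"
    have S: "?S \<in> sets N"
      by (intro Collect_in_N) measurable
    have "(\<integral>\<^sup>+x. weight p t * (if A x t then 1 else 0) \<partial>PiM I (\<lambda>_. N))
        = (\<integral>\<^sup>+x. weight p t * indicator (PiE I (\<lambda>_. ?S)) x \<partial>PiM I (\<lambda>_. N))"
      by (intro nn_integral_cong) (auto simp: A_def indicator_def space_PiM PiE_iff)
    also have "\<dots> = weight p t * emeasure (PiM I (\<lambda>_. N)) (PiE I (\<lambda>_. ?S))"
      using S I by (intro nn_integral_cmult_indicator sets_PiM_I_finite) auto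
    also have "emeasure (PiM I (\<lambda>_. N)) (PiE I (\<lambda>_. ?S)) = ennreal (surv t ^ card I)"
      using S I by (subst P.emeasure_PiM) (auto simp: surv_def emeasure_eq_measure ennreal_power)
    finally show "(\<integral>\<^sup>+x. weight p t * (if A x t then 1 else 0) \<partial>PiM I (\<lambda>_. N)) = weight p t * ennreal (surv t ^ card I)" .
  qed
  finally show ?thesis .
qed

lemma moment_tendsto:
  assumes I: "\<And>a. finite (I a)" "\<And>a. card (I a) = a" and p: "\<And>i. 0 < p i"
  shows "(\<lambda>a. ennreal (real a ^ (\<Sum>i\<in>UNIV. p i)) * moment (I a) p) \<longlonglongrightarrow> ennreal (\<Prod>i\<in>UNIV. fact (p i) / c ^ p i)"
proof -
  \<comment> \<open>At \<open>a = 0\<close> the power would be 1, which the majorant does not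
    dominate. The value 0 keeps the bound valid for every \<open>a\<close> and leaves the limit
    unchanged.\<close>
  let ?g = "\<lambda>a s. if a = 0 then 0 else surv (s /\<^sub>R real a) ^ a"
  let ?f = "\<lambda>a s. weight p s * ennreal (?g a s)"
  let ?r = "\<kappa> / CARD('k)"
  have r: "0 < ?r"
    using \<kappa>_pos by simp
  have "(\<lambda>a. \<integral>\<^sup>+s. ?f a s \<partial>lborel) \<longlonglongrightarrow> (\<integral>\<^sup>+s. weight p s * ennreal (exp (- c * (\<Sum>i\<in>UNIV. s $ i))) \<partial>lborel)"
  proof (rule nn_integral_dominated_convergence[where w = "\<lambda>s. weight p s * ennreal (exp (- ?r * (\<Sum>i\<in>UNIV. s $ i)))"])
    show "(\<integral>\<^sup>+s. weight p s * ennreal (exp (- ?r * (\<Sum>i\<in>UNIV. s $ i))) \<partial>lborel) < \<infinity>"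
      by (subst nn_integral_weight_exp[OF p r]) simp
    show "AE s in lborel. ?f a s \<le> weight p s * ennreal (exp (- ?r * (\<Sum>i\<in>UNIV. s $ i)))" for a
    proof (rule AE_I2)
      fix s :: "real ^ 'k"
      show "?f a s \<le> weight p s * ennreal (exp (- ?r * (\<Sum>i\<in>UNIV. s $ i)))"
      proof (cases "a = 0 \<or> \<not> (\<forall>i. 0 < s $ i)")
        case True
        then show ?thesis
          by (auto simp: weight_eq_0)
      next
        case False
        then have "surv (s /\<^sub>R real a) ^ a \<le> exp (- ?r * (\<Sum>i\<in>UNIV. (s /\<^sub>R real a) $ i)) ^ a"
          by (intro power_mono surv_bound surv_nonneg) (auto simp: less_imp_le)
        also have "\<dots> = exp (- ?r * (\<Sum>i\<in>UNIV. s $ i))"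
          using False by (simp add: exp_of_nat_mult[symmetric] sum_distrib_left[symmetric])
        finally show ?thesis
          using False by (intro mult_left_mono ennreal_leI) auto
      qed
    qed
    show "AE s in lborel. (\<lambda>a. ?f a s) \<longlonglongrightarrow> weight p s * ennreal (exp (- c * (\<Sum>i\<in>UNIV. s $ i)))"
    proof (rule AE_I2)
      fix s :: "real ^ 'k"
      show "(\<lambda>a. ?f a s) \<longlonglongrightarrow> weight p s * ennreal (exp (- c * (\<Sum>i\<in>UNIV. s $ i)))"
      proof (cases "\<forall>i. 0 < s $ i")
        case True
        then have "(\<lambda>a. surv (s /\<^sub>R real a) ^ a) \<longlonglongrightarrow> exp (- c * (\<Sum>i\<in>UNIV. s $ i))"
          by (intro surv_power_tendsto) auto
        then have "(\<lambda>a. ?g a s) \<longlonglongrightarrow> exp (- c * (\<Sum>i\<in>UNIV. s $ i))"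
          by (rule Lim_transform_eventually) (auto intro: eventually_mono[OF eventually_gt_at_top[of 0]])
        then have "(\<lambda>a. ennreal (?g a s)) \<longlonglongrightarrow> ennreal (exp (- c * (\<Sum>i\<in>UNIV. s $ i)))"
          by (rule tendsto_ennrealI)
        then show ?thesis
          by (intro ennreal_tendsto_cmult) (auto simp: weight_def ennreal_prod_eq_top less_top[symmetric])
      next
        case False
        then show ?thesis
          by (auto simp: weight_eq_0)
      qed
    qed
  qed measurable
  also have "(\<integral>\<^sup>+s. weight p s * ennreal (exp (- c * (\<Sum>i\<in>UNIV. s $ i))) \<partial>lborel) = ennreal (\<Prod>i\<in>UNIV. fact (p i) / c ^ p i)"
    by (rule nn_integral_weight_exp[OF p c_pos])
  finally show ?thesis
  proof (rule Lim_transform_eventually)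
    show "\<forall>\<^sub>F a in sequentially. (\<integral>\<^sup>+s. ?f a s \<partial>lborel) = ennreal (real a ^ (\<Sum>i\<in>UNIV. p i)) * moment (I a) p"
      using eventually_gt_at_top[of 0]
    proof eventually_elim
      case (elim a)
      have "I a \<noteq> {}"
        using I[of a] elim by auto
      then have "moment (I a) p = (\<integral>\<^sup>+t. weight p t * ennreal (surv t ^ a) \<partial>lborel)"
        using I by (subst moment_eq) (auto simp: p)
      also have "\<dots> = ennreal (\<bar>1 / real a\<bar> ^ DIM(real ^ 'k)) *
          (\<integral>\<^sup>+s. weight p ((1 / real a) *\<^sub>R s) * ennreal (surv ((1 / real a) *\<^sub>R s) ^ a) \<partial>lborel)"
        using elim by (intro nn_integral_lborel_scale) auto
      finally have X: "ennreal (real a ^ (\<Sum>i\<in>UNIV. p i)) * moment (I a) p =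
         (\<integral>\<^sup>+s. (ennreal (real a ^ (\<Sum>i\<in>UNIV. p i)) * ennreal ((1 / real a) ^ CARD('k)) * weight p ((1 / real a) *\<^sub>R s))
            * ennreal (surv ((1 / real a) *\<^sub>R s) ^ a) \<partial>lborel)"
        by (simp add: mult.assoc nn_integral_cmult)
      \<comment> \<open>Homogeneity of \<open>weight p\<close> gives the factor
        \<open>a ^ (k - (\<Sum>i. p i))\<close> and the Jacobian gives \<open>a ^ (- k)\<close>;
        together they cancel the normalization.\<close>
      have scale: "ennreal (real a ^ (\<Sum>i\<in>UNIV. p i)) * ennreal ((1 / real a) ^ CARD('k)) * weight p ((1 / real a) *\<^sub>R s)
          = weight p s" for s :: "real ^ 'k"
      proof -
        have "ennreal (real a ^ (\<Sum>i\<in>UNIV. p i)) * ennreal ((1 / real a) ^ CARD('k)) =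
            (\<Prod>i\<in>UNIV. ennreal (real a ^ p i * (1 / real a)))"
        proof -
          have "(\<Prod>i\<in>UNIV. ennreal (real a ^ p i * (1 / real a)))
              = ennreal (real a ^ (\<Sum>i\<in>UNIV. p i) * (1 / real a) ^ CARD('k))"
            by (subst prod_ennreal) (auto simp: prod.distrib power_sum power_divide prod_dividef)
          then show ?thesis
            by (simp only: ennreal_mult zero_le_power of_nat_0_le_iff zero_le_divide_1_iff)
        qed
        then have "ennreal (real a ^ (\<Sum>i\<in>UNIV. p i)) * ennreal ((1 / real a) ^ CARD('k)) * weight p ((1 / real a) *\<^sub>R s)
          = (\<Prod>i\<in>UNIV. ennreal (real a ^ p i * (1 / real a)) * (if 0 < s $ i / real a then ennreal (real (p i) * (s $ i / real a) ^ (p i - 1)) else 0))"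
        proof -
          have "((1 / real a) *\<^sub>R s) $ i = s $ i / real a" for i
            by simp
          then show ?thesis
            using \<open>ennreal (real a ^ (\<Sum>i\<in>UNIV. p i)) * ennreal ((1 / real a) ^ CARD('k)) = _\<close>
            by (simp only: weight_def prod.distrib)
        qed
        also have "\<dots> = weight p s"
          unfolding weight_def
        proof (rule prod.cong)
          fix i :: 'k
          have "real a ^ p i * (1 / real a) * (real (p i) * (s $ i / real a) ^ (p i - 1)) = real (p i) * s $ i ^ (p i - 1)"
            using elim p[of i] by (cases "p i") (auto simp: power_divide)
          then show "ennreal (real a ^ p i * (1 / real a)) * (if 0 < s $ i / real a then ennreal (real (p i) * (s $ i / real a) ^ (p i - 1)) else 0)
            = (if 0 < s $ i then ennreal (real (p i) * s $ i ^ (p i - 1)) else 0)"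
            using elim by (auto simp: ennreal_mult[symmetric] zero_less_divide_iff simp del: times_divide_eq_right)
        qed simp
        finally show ?thesis .
      qed
      show ?case
        unfolding X scale using elim by (simp add: divide_inverse_commute)
    qed
  qed
qed

section \<open>Separation of a fixed index set from the remaining indices\<close>

definition separated :: "nat set \<Rightarrow> nat set \<Rightarrow> (nat \<Rightarrow> real ^ 'k) \<Rightarrow> bool" where
  "separated B I x \<longleftrightarrow> (\<forall>i. \<forall>n\<in>B. \<forall>m\<in>I. \<bar>x n $ i\<bar> < \<bar>x m $ i\<bar>)"

lemma measurable_compare_components:
  assumes [measurable]: "n \<in> S" "m \<in> S"
  shows "Measurable.pred (PiM S (\<lambda>_. N)) (\<lambda>x. \<bar>x n $ i\<bar> \<le> \<bar>x m $ i\<bar>)"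
    and "Measurable.pred (PiM S (\<lambda>_. N)) (\<lambda>x. \<bar>x n $ i\<bar> < \<bar>x m $ i\<bar>)"
proof -
  have "(\<lambda>x. \<bar>x k $ i\<bar>) \<in> borel_measurable (PiM S (\<lambda>_. N))" if [measurable]: "k \<in> S" for k
    by measurable
  note [measurable] = this[OF assms(1)] this[OF assms(2)]
  show "Measurable.pred (PiM S (\<lambda>_. N)) (\<lambda>x. \<bar>x n $ i\<bar> \<le> \<bar>x m $ i\<bar>)"
    unfolding pred_def by (intro borel_measurable_le; fact)
  show "Measurable.pred (PiM S (\<lambda>_. N)) (\<lambda>x. \<bar>x n $ i\<bar> < \<bar>x m $ i\<bar>)"
    unfolding pred_def by (intro borel_measurable_less; fact)
qed

lemma measurable_separated [measurable]:
  assumes "B \<subseteq> S" "I \<subseteq> S"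
  shows "Measurable.pred (PiM S (\<lambda>_. N)) (separated B I)"
proof -
  have "Measurable.pred (PiM S (\<lambda>_. N)) (\<lambda>x. \<bar>x n $ i\<bar> < \<bar>x m $ i\<bar>)" if "n \<in> B" "m \<in> I" for n m i
    using that assms by (intro measurable_compare_components) auto
  then show ?thesis
    unfolding separated_def by (intro pred_intros_countable(1) pred_intros_countable_bounded(3))
qed

text \<open>The function \<open>F\<close> of the overview.\<close>

definition box_prob :: "real ^ 'k \<Rightarrow> real" where
  "box_prob t = prob {x. \<forall>i. \<bar>x $ i\<bar> < t $ i}"

lemma measurable_box_prob [measurable]: "box_prob \<in> borel_measurable borel"
  unfolding box_prob_def[abs_def] by (rule measurable_prob_Collect) measurable

text \<open>Fubini over \<open>I\<close> and \<open>B\<close> takes the place of conditioning: with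
  the vectors of \<open>I\<close> fixed, separation asks each vector of \<open>B\<close>,
  independently, to lie in the box below \<open>least I x\<close>.\<close>

lemma emeasure_separated:
  assumes I: "finite I" "I \<noteq> {}" and B: "finite B" "I \<inter> B = {}"
  shows "emeasure (PiM (I \<union> B) (\<lambda>_. N)) {x \<in> space (PiM (I \<union> B) (\<lambda>_. N)). separated B I x}
    = (\<integral>\<^sup>+x. ennreal (box_prob (least I x) ^ card B) \<partial>PiM I (\<lambda>_. N))"
proof -
  interpret P: product_prob_space "\<lambda>_. N" "I \<union> B"
    by unfold_locales
  let ?S = "{x \<in> space (PiM (I \<union> B) (\<lambda>_. N)). separated B I x}"
  have [measurable]: "?S \<in> sets (PiM (I \<union> B) (\<lambda>_. N))"
    by measurable
  have "emeasure (PiM (I \<union> B) (\<lambda>_. N)) ?S = (\<integral>\<^sup>+x. indicator ?S x \<partial>PiM (I \<union> B) (\<lambda>_. N))"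
    by simp
  also have "\<dots> = (\<integral>\<^sup>+x. \<integral>\<^sup>+y. indicator ?S (merge I B (x, y)) \<partial>PiM B (\<lambda>_. N) \<partial>PiM I (\<lambda>_. N))"
    using I B by (intro P.product_nn_integral_fold) auto
  also have "\<dots> = (\<integral>\<^sup>+x. ennreal (box_prob (least I x) ^ card B) \<partial>PiM I (\<lambda>_. N))"
  proof (rule nn_integral_cong)
    fix x assume x: "x \<in> space (PiM I (\<lambda>_. N))"
    let ?Q = "{y. \<forall>i. \<bar>y $ i\<bar> < least I x $ i} :: (real ^ 'k) set"
    have Q: "?Q \<in> sets N"
      by (intro Collect_in_N) measurable
    have "(\<integral>\<^sup>+y. indicator ?S (merge I B (x, y)) \<partial>PiM B (\<lambda>_. N))
        = (\<integral>\<^sup>+y. indicator (PiE B (\<lambda>_. ?Q)) y \<partial>PiM B (\<lambda>_. N))"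
    proof (rule nn_integral_cong)
      fix y assume y: "y \<in> space (PiM B (\<lambda>_. N))"
      have "merge I B (x, y) \<in> space (PiM (I \<union> B) (\<lambda>_. N))"
        by (auto simp: space_PiM PiE_iff merge_def extensional_def)
      moreover have "separated B I (merge I B (x, y)) \<longleftrightarrow> (\<forall>n\<in>B. y n \<in> ?Q)"
        using I B by (auto simp: separated_def less_least_iff merge_def)
      ultimately have "merge I B (x, y) \<in> ?S \<longleftrightarrow> y \<in> PiE B (\<lambda>_. ?Q)"
        using y by (auto simp: space_PiM PiE_iff)
      then show "indicator ?S (merge I B (x, y)) = (indicator (PiE B (\<lambda>_. ?Q)) y :: ennreal)"
        by (simp add: indicator_def)
    qed
    also have "\<dots> = emeasure (PiM B (\<lambda>_. N)) (PiE B (\<lambda>_. ?Q))"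
      using Q B by (intro nn_integral_indicator sets_PiM_I_finite) auto
    also have "\<dots> = ennreal (box_prob (least I x) ^ card B)"
      using Q B by (subst P.emeasure_PiM) (auto simp: box_prob_def emeasure_eq_measure ennreal_power)
    finally show "(\<integral>\<^sup>+y. indicator ?S (merge I B (x, y)) \<partial>PiM B (\<lambda>_. N)) = ennreal (box_prob (least I x) ^ card B)" .
  qed
  finally show ?thesis .
qed

text \<open>With \<open>y = C * (\<Sum>i. (t $ i)\<^sup>2)\<close>, Bernoulli's inequality replaces
  \<open>(1 - y) ^ b\<close> by \<open>1 - b * y\<close> when \<open>y \<le> 1\<close>; when
  \<open>y > 1\<close> this factor is negative and the bound is trivial. The correction stands on
  the right and is expanded into monomials, so that both sides integrate termwise in
  \<open>ennreal\<close> to moments.\<close>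

lemma box_prob_power_lower:
  assumes t: "\<And>i. 0 \<le> t $ i" and b: "0 < b"
  shows "K ^ b * (\<Prod>i\<in>UNIV. t $ i ^ b) \<le> box_prob t ^ b
    + (\<Sum>j\<in>UNIV. K ^ b * (real b * C) * (\<Prod>i\<in>UNIV. t $ i ^ (if i = j then b + 2 else b)))"
proof -
  let ?P = "K * (\<Prod>i\<in>UNIV. t $ i)" and ?y = "C * (\<Sum>i\<in>UNIV. (t $ i)\<^sup>2)"
  have P0: "0 \<le> ?P"
    using K_pos t by (simp add: prod_nonneg)
  have y0: "0 \<le> ?y"
    using C_nonneg by (simp add: sum_nonneg)
  have "?P ^ b * (1 - real b * ?y) \<le> box_prob t ^ b"
  proof (cases "?y \<le> 1")
    case True
    have "?P ^ b * (1 - real b * ?y) \<le> ?P ^ b * (1 - ?y) ^ b"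
      using True P0 Bernoulli_inequality[of "- ?y" b] by (intro mult_left_mono) auto
    also have "\<dots> = (?P * (1 - ?y)) ^ b"
      by (simp add: power_mult_distrib)
    also have "\<dots> \<le> box_prob t ^ b"
      using box_lower[OF t] True mult_nonneg_nonneg[OF P0, of "1 - ?y"]
      by (intro power_mono) (auto simp: box_prob_def)
    finally show ?thesis .
  next
    case False
    then have "1 * 1 \<le> real b * ?y"
      using b by (intro mult_mono) auto
    then have "?P ^ b * (1 - real b * ?y) \<le> 0"
      using P0 by (intro mult_nonneg_nonpos) auto
    also have "0 \<le> box_prob t ^ b"
      by (simp add: box_prob_def)
    finally show ?thesis .
  qed
  moreover have "?P ^ b = K ^ b * (\<Prod>i\<in>UNIV. t $ i ^ b)"
    by (simp add: power_mult_distrib prod_power_distrib)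
  moreover have "(\<Sum>j\<in>UNIV. K ^ b * (real b * C) * (\<Prod>i\<in>UNIV. t $ i ^ (if i = j then b + 2 else b)))
      = K ^ b * (\<Prod>i\<in>UNIV. t $ i ^ b) * (real b * ?y)"
  proof -
    have "(\<Prod>i\<in>UNIV. t $ i ^ (if i = j then b + 2 else b)) = (\<Prod>i\<in>UNIV. t $ i ^ b) * (t $ j)\<^sup>2" for j
    proof -
      have "(\<Prod>i\<in>UNIV. t $ i ^ (if i = j then b + 2 else b)) = (\<Prod>i\<in>UNIV. t $ i ^ b * (if i = j then (t $ j)\<^sup>2 else 1))"
        by (intro prod.cong) (auto simp: power_add power2_eq_square)
      then show ?thesis
        by (simp add: prod.distrib)
    qed
    then show ?thesis
      by (simp add: sum_distrib_left ac_simps)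
  qed
  ultimately show ?thesis
    by (simp add: right_diff_distrib)
qed

lemma box_prob_power_upper:
  assumes t: "\<And>i. 0 \<le> t $ i"
  shows "box_prob t ^ b \<le> K ^ b * (\<Prod>i\<in>UNIV. t $ i ^ b)"
proof -
  have "box_prob t ^ b \<le> (K * (\<Prod>i\<in>UNIV. t $ i)) ^ b"
    using box_upper[OF t] by (intro power_mono) (auto simp: box_prob_def)
  then show ?thesis
    by (simp add: power_mult_distrib prod_power_distrib)
qed

lemma separated_prob_tendsto:
  assumes b: "0 < b"
    and I: "\<And>a. finite (I a)" "\<And>a. card (I a) = a" and B: "finite B" "card B = b" "\<And>a. I a \<inter> B = {}"
  shows "(\<lambda>a. real a ^ (CARD('k) * b) *
      measure (PiM (I a \<union> B) (\<lambda>_. N)) {x \<in> space (PiM (I a \<union> B) (\<lambda>_. N)). separated B (I a) x})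
    \<longlonglongrightarrow> K ^ b * (fact b / c ^ b) ^ CARD('k)"
proof -
  define Q where "Q a = measure (PiM (I a \<union> B) (\<lambda>_. N)) {x \<in> space (PiM (I a \<union> B) (\<lambda>_. N)). separated B (I a) x}" for a
  \<comment> \<open>The exponents of the \<open>j\<close>-th correction monomial. Their sum is
    \<open>k * b + 2\<close>, so the corresponding moment still vanishes after multiplication by
    \<open>a ^ (k * b)\<close>.\<close>
  define p where "p j i = (if i = j then b + 2 else b)" for i j :: 'k
  define L where "L = (fact b / c ^ b) ^ CARD('k)"
  have L0: "0 \<le> L"
    using c_pos by (simp add: L_def)
  have Q: "ennreal (Q a) = (\<integral>\<^sup>+x. ennreal (box_prob (least (I a) x) ^ b) \<partial>PiM (I a) (\<lambda>_. N))" if "0 < a" for a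
  proof -
    interpret P: prob_space "PiM (I a \<union> B) (\<lambda>_. N)"
      by (intro prob_space_PiM) unfold_locales
    have "I a \<noteq> {}"
      using I(2)[of a] that by auto
    then show ?thesis
      using emeasure_separated[of "I a" B] I B by (simp add: Q_def P.emeasure_eq_measure)
  qed
  have up: "ennreal (Q a) \<le> ennreal (K ^ b) * moment (I a) (\<lambda>_. b)" if "0 < a" for a
  proof -
    have ne: "I a \<noteq> {}"
      using I(2)[of a] that by auto
    have "ennreal (Q a) \<le> (\<integral>\<^sup>+x. ennreal (K ^ b) * (\<Prod>i\<in>UNIV. ennreal (least (I a) x $ i ^ b)) \<partial>PiM (I a) (\<lambda>_. N))"
      unfolding Q[OF that] using least_nonneg[OF I(1) ne] K_pos
      by (intro nn_integral_mono)
        (auto simp: prod_ennreal ennreal_mult[symmetric] prod_nonneg intro!: ennreal_leI box_prob_power_upper)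
    also have "\<dots> = ennreal (K ^ b) * moment (I a) (\<lambda>_. b)"
      unfolding moment_def using I by (intro nn_integral_cmult) measurable
    finally show ?thesis .
  qed
  have low: "ennreal (K ^ b) * moment (I a) (\<lambda>_. b) \<le> ennreal (Q a) + (\<Sum>j\<in>UNIV. ennreal (K ^ b * (real b * C)) * moment (I a) (p j))"
    if "0 < a" for a
  proof -
    have ne: "I a \<noteq> {}"
      using I(2)[of a] that by auto
    have [measurable]: "(\<lambda>x. least (I a) x $ i) \<in> borel_measurable (PiM (I a) (\<lambda>_. N))" for i
      using I by measurable
    have "(\<lambda>x. least (I a) x) \<in> borel_measurable (PiM (I a) (\<lambda>_. N))"
      by (subst borel_measurable_euclidean_space) (auto simp: Basis_vec_def inner_axis)
    then have [measurable]: "(\<lambda>x. box_prob (least (I a) x)) \<in> borel_measurable (PiM (I a) (\<lambda>_. N))"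
      by (rule measurable_compose) measurable
    have "ennreal (K ^ b) * moment (I a) (\<lambda>_. b) = (\<integral>\<^sup>+x. ennreal (K ^ b * (\<Prod>i\<in>UNIV. least (I a) x $ i ^ b)) \<partial>PiM (I a) (\<lambda>_. N))"
      unfolding moment_def using K_pos I ne
      by (subst nn_integral_cmult[symmetric]) (auto simp: prod_ennreal ennreal_mult[symmetric] prod_nonneg least_nonneg)
    also have "\<dots> \<le> (\<integral>\<^sup>+x. ennreal (box_prob (least (I a) x) ^ b)
        + (\<Sum>j\<in>UNIV. ennreal (K ^ b * (real b * C)) * (\<Prod>i\<in>UNIV. ennreal (least (I a) x $ i ^ p j i))) \<partial>PiM (I a) (\<lambda>_. N))"
    proof (rule nn_integral_mono)
      fix x
      let ?t = "least (I a) x"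
      have t: "0 \<le> ?t $ i" for i
        using I ne by (intro least_nonneg)
      have "ennreal (K ^ b * (\<Prod>i\<in>UNIV. ?t $ i ^ b))
         \<le> ennreal (box_prob ?t ^ b + (\<Sum>j\<in>UNIV. K ^ b * (real b * C) * (\<Prod>i\<in>UNIV. ?t $ i ^ p j i)))"
        unfolding p_def by (intro ennreal_leI box_prob_power_lower t b)
      also have "\<dots> = ennreal (box_prob ?t ^ b) + (\<Sum>j\<in>UNIV. ennreal (K ^ b * (real b * C)) * (\<Prod>i\<in>UNIV. ennreal (?t $ i ^ p j i)))"
        using t K_pos C_nonneg
        by (simp add: prod_ennreal ennreal_mult[symmetric] prod_nonneg sum_ennreal ennreal_plus[symmetric] sum_nonneg box_prob_def
            del: ennreal_plus)
      finally show "ennreal (K ^ b * (\<Prod>i\<in>UNIV. ?t $ i ^ b)) \<le> ennreal (box_prob ?t ^ b)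
        + (\<Sum>j\<in>UNIV. ennreal (K ^ b * (real b * C)) * (\<Prod>i\<in>UNIV. ennreal (?t $ i ^ p j i)))" .
    qed
    also have "\<dots> = ennreal (Q a) + (\<Sum>j\<in>UNIV. ennreal (K ^ b * (real b * C)) * moment (I a) (p j))"
      unfolding Q[OF that] moment_def
      by (subst nn_integral_add) (simp_all add: nn_integral_sum nn_integral_cmult)
    finally show ?thesis .
  qed
  have m1: "(\<lambda>a. ennreal (real a ^ (CARD('k) * b)) * (ennreal (K ^ b) * moment (I a) (\<lambda>_. b))) \<longlonglongrightarrow> ennreal (K ^ b * L)"
  proof -
    have "(\<lambda>a. ennreal (K ^ b) * (ennreal (real a ^ (\<Sum>i\<in>(UNIV :: 'k set). b)) * moment (I a) (\<lambda>_. b)))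
       \<longlonglongrightarrow> ennreal (K ^ b) * ennreal (\<Prod>i\<in>(UNIV :: 'k set). fact b / c ^ b)"
      by (intro ennreal_tendsto_cmult moment_tendsto I b) simp
    then show ?thesis
      using K_pos L0 by (simp add: L_def ennreal_mult ac_simps)
  qed
  have m2: "(\<lambda>a. ennreal (real a ^ (CARD('k) * b)) * (ennreal (K ^ b * (real b * C)) * moment (I a) (p j))) \<longlonglongrightarrow> 0" for j
  proof -
    have sum_p: "(\<Sum>i\<in>UNIV. p j i) = CARD('k) * b + 2"
    proof -
      have "(\<Sum>i\<in>UNIV. p j i) = (\<Sum>i\<in>UNIV. b + (if i = j then 2 else 0))"
        by (intro sum.cong) (auto simp: p_def)
      then show ?thesis
        by (simp add: sum.distrib)
    qed
    have "(\<lambda>a. 1 / real a) \<longlonglongrightarrow> 0"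
      by (rule lim_const_over_n)
    then have "(\<lambda>a. (1 / real a)\<^sup>2) \<longlonglongrightarrow> 0"
      by (rule tendsto_null_power) simp
    then have z: "(\<lambda>a. ennreal ((1 / real a)\<^sup>2)) \<longlonglongrightarrow> ennreal 0"
      by (rule tendsto_ennrealI)
    have "(\<lambda>a. ennreal (K ^ b * (real b * C)) * (ennreal ((1 / real a)\<^sup>2) * (ennreal (real a ^ (\<Sum>i\<in>UNIV. p j i)) * moment (I a) (p j))))
       \<longlonglongrightarrow> ennreal (K ^ b * (real b * C)) * (ennreal 0 * ennreal (\<Prod>i\<in>UNIV. fact (p j i) / c ^ p j i))"
      using b by (intro ennreal_tendsto_cmult tendsto_mult_ennreal z moment_tendsto I) (auto simp: p_def)
    then show ?thesis
    proof (rule Lim_transform_eventually[THEN tendsto_eq_rhs])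
      show "\<forall>\<^sub>F a in sequentially. ennreal (K ^ b * (real b * C)) * (ennreal ((1 / real a)\<^sup>2) * (ennreal (real a ^ (\<Sum>i\<in>UNIV. p j i)) * moment (I a) (p j)))
        = ennreal (real a ^ (CARD('k) * b)) * (ennreal (K ^ b * (real b * C)) * moment (I a) (p j))"
        using eventually_gt_at_top[of 0]
      proof eventually_elim
        case (elim a)
        then have "(1 / real a)\<^sup>2 * real a ^ (\<Sum>i\<in>UNIV. p j i) = real a ^ (CARD('k) * b)"
          by (simp add: sum_p power_add power2_eq_square)
        then have "ennreal ((1 / real a)\<^sup>2) * ennreal (real a ^ (\<Sum>i\<in>UNIV. p j i)) = ennreal (real a ^ (CARD('k) * b))"
          by (simp only: ennreal_mult[symmetric] zero_le_power zero_le_power2 of_nat_0_le_iff)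
        moreover have "k * (z * (x * m)) = (z * x) * (k * m)" for k z x m :: ennreal
          by (simp add: ac_simps)
        ultimately show ?case
          by (simp only:)
      qed
    qed simp
  qed
  have "(\<lambda>a. \<Sum>j\<in>UNIV. ennreal (real a ^ (CARD('k) * b)) * (ennreal (K ^ b * (real b * C)) * moment (I a) (p j))) \<longlonglongrightarrow> 0"
    by (intro tendsto_null_sum m2)
  \<comment> \<open>In \<open>ennreal\<close> the step from \<open>x \<le> z + y\<close> to
    \<open>x - y \<le> z\<close> is safe for finite \<open>y\<close>; the bound 1 is an arbitrary
    finite one.\<close>
  then have fin: "\<forall>\<^sub>F a in sequentially.
      (\<Sum>j\<in>UNIV. ennreal (real a ^ (CARD('k) * b)) * (ennreal (K ^ b * (real b * C)) * moment (I a) (p j))) < 1"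
    by (rule order_tendstoD(2)) simp
  have "(\<lambda>a. ennreal (real a ^ (CARD('k) * b)) * ennreal (Q a)) \<longlonglongrightarrow> ennreal (K ^ b * L)"
  proof (rule tendsto_sandwich[rotated 2])
    have "(\<lambda>a. ennreal (real a ^ (CARD('k) * b)) * (ennreal (K ^ b) * moment (I a) (\<lambda>_. b)) -
       (\<Sum>j\<in>UNIV. ennreal (real a ^ (CARD('k) * b)) * (ennreal (K ^ b * (real b * C)) * moment (I a) (p j)))) \<longlonglongrightarrow> ennreal (K ^ b * L) - (\<Sum>j\<in>(UNIV :: 'k set). 0)"
      by (intro tendsto_diff_ennreal tendsto_sum m1 m2) auto
    then show "(\<lambda>a. ennreal (real a ^ (CARD('k) * b)) * (ennreal (K ^ b) * moment (I a) (\<lambda>_. b)) -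
       (\<Sum>j\<in>UNIV. ennreal (real a ^ (CARD('k) * b)) * (ennreal (K ^ b * (real b * C)) * moment (I a) (p j)))) \<longlonglongrightarrow> ennreal (K ^ b * L)"
      by simp
    show "(\<lambda>a. ennreal (real a ^ (CARD('k) * b)) * (ennreal (K ^ b) * moment (I a) (\<lambda>_. b))) \<longlonglongrightarrow> ennreal (K ^ b * L)"
      by (rule m1)
    show "\<forall>\<^sub>F a in sequentially. ennreal (real a ^ (CARD('k) * b)) * (ennreal (K ^ b) * moment (I a) (\<lambda>_. b)) -
       (\<Sum>j\<in>UNIV. ennreal (real a ^ (CARD('k) * b)) * (ennreal (K ^ b * (real b * C)) * moment (I a) (p j)))
       \<le> ennreal (real a ^ (CARD('k) * b)) * ennreal (Q a)"
      using eventually_gt_at_top[of 0] fin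
    proof eventually_elim
      case (elim a)
      have "x - y \<le> z" if "x \<le> z + y" "y < 1" for x y z :: ennreal
        using that by (auto simp: ennreal_minus_le_iff add.commute)
      then show ?case
        using mult_left_mono[OF low[OF elim(1)], of "ennreal (real a ^ (CARD('k) * b))"] elim(2)
        by (simp add: distrib_left sum_distrib_left)
    qed
    show "\<forall>\<^sub>F a in sequentially. ennreal (real a ^ (CARD('k) * b)) * ennreal (Q a)
       \<le> ennreal (real a ^ (CARD('k) * b)) * (ennreal (K ^ b) * moment (I a) (\<lambda>_. b))"
      using eventually_gt_at_top[of 0]
      by eventually_elim (intro mult_left_mono up; simp)
  qed
  then have "(\<lambda>a. ennreal (real a ^ (CARD('k) * b) * Q a)) \<longlonglongrightarrow> ennreal (K ^ b * L)"
    by (simp add: ennreal_mult Q_def)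
  then show ?thesis
    unfolding L_def Q_def by (rule tendsto_ennrealD) (use K_pos c_pos in auto)
qed

text \<open>With all vectors other than \<open>x n\<close> fixed, a tie confines
  \<open>|x n $ i|\<close> to a single value, which has probability 0 by \<open>no_atom\<close>.
  Tie-breaking by index therefore does not influence the collision probability.\<close>

lemma AE_no_tie:
  assumes "finite S"
  shows "AE x in PiM S (\<lambda>_. N). \<forall>i. \<forall>n\<in>S. \<forall>m\<in>S - {n}. \<bar>x n $ i\<bar> \<noteq> \<bar>x m $ i\<bar>"
proof -
  have tie: "AE x in PiM S (\<lambda>_. N). \<bar>x n $ i\<bar> \<noteq> \<bar>x m $ i\<bar>" if n: "n \<in> S" and m: "m \<in> S - {n}" for n m i
  proof -
    interpret P: product_prob_space "\<lambda>_. N" S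
      by unfold_locales
    have S: "S = insert n (S - {n})"
      using n by auto
    have [measurable]: "n \<in> S" "m \<in> S"
      using n m by auto
    let ?T = "{x \<in> space (PiM S (\<lambda>_. N)). \<bar>x n $ i\<bar> = \<bar>x m $ i\<bar>}"
    have T: "?T \<in> sets (PiM S (\<lambda>_. N))"
      by measurable
    have "emeasure (PiM S (\<lambda>_. N)) ?T = (\<integral>\<^sup>+x. indicator ?T x \<partial>PiM S (\<lambda>_. N))"
      using T by simp
    also have "\<dots> = (\<integral>\<^sup>+x. \<integral>\<^sup>+y. indicator ?T (x(n := y)) \<partial>N \<partial>PiM (S - {n}) (\<lambda>_. N))"
      using assms T S by (subst (1) S, intro P.product_nn_integral_insert) auto
    also have "\<dots> = (\<integral>\<^sup>+x. 0 \<partial>PiM (S - {n}) (\<lambda>_. N))"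
    proof (rule nn_integral_cong)
      fix x assume x: "x \<in> space (PiM (S - {n}) (\<lambda>_. N))"
      have "(\<integral>\<^sup>+y. indicator ?T (x(n := y)) \<partial>N) = (\<integral>\<^sup>+y. indicator {y. \<bar>y $ i\<bar> = \<bar>x m $ i\<bar>} y \<partial>N)"
        using x n m by (intro nn_integral_cong) (auto simp: indicator_def space_PiM PiE_iff extensional_def)
      also have "\<dots> = emeasure N {y. \<bar>y $ i\<bar> = \<bar>x m $ i\<bar>}"
        by (intro nn_integral_indicator Collect_in_N) measurable
      also have "\<dots> = 0"
        by (simp add: emeasure_eq_measure no_atom)
      finally show "(\<integral>\<^sup>+y. indicator ?T (x(n := y)) \<partial>N) = 0" .
    qed
    finally have "?T \<in> null_sets (PiM S (\<lambda>_. N))"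
      using T by (simp add: null_sets_def)
    then show ?thesis
      by (rule AE_I') auto
  qed
  show ?thesis
    using assms tie by (simp add: AE_all_countable AE_finite_all)
qed

lemma separated_prob_exchangeable:
  assumes S: "finite S" and B: "B \<subseteq> S" "B' \<subseteq> S" "card B = card B'"
  shows "measure (PiM S (\<lambda>_. N)) {x \<in> space (PiM S (\<lambda>_. N)). separated B (S - B) x}
    = measure (PiM S (\<lambda>_. N)) {x \<in> space (PiM S (\<lambda>_. N)). separated B' (S - B') x}"
proof -
  have fin: "finite B" "finite B'"
    using S B finite_subset by blast+
  obtain f where f: "bij_betw f B B'"
    using finite_same_card_bij[OF fin B(3)] by blast
  have "card (S - B) = card (S - B')"
    using B S fin by (simp add: card_Diff_subset)
  then obtain g where g: "bij_betw g (S - B) (S - B')"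
    using finite_same_card_bij[of "S - B" "S - B'"] S by blast
  \<comment> \<open>A permutation of \<open>S\<close> that takes \<open>B\<close> to
    \<open>B'\<close> and complement to complement. A product of equal factors is invariant under
    reindexing by it.\<close>
  define h where "h n = (if n \<in> B then f n else g n)" for n
  have "bij_betw h (B \<union> (S - B)) (B' \<union> (S - B'))"
    unfolding h_def using f g by (intro bij_betw_disjoint_Un) auto
  then have h: "bij_betw h S S"
    using B by (simp add: Un_absorb1)
  have hB: "h ` B = B'" and hC: "h ` (S - B) = S - B'"
    using f g by (auto simp: h_def bij_betw_def image_iff)
  let ?P = "PiM S (\<lambda>_. N)"
  let ?t = "\<lambda>x. \<lambda>n\<in>S. x (h n)"
  have t [measurable]: "?t \<in> measurable ?P ?P"
    using h by (intro measurable_restrict measurable_component_singleton) (auto simp: bij_betw_def)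
  have D: "distr ?P ?P ?t = ?P"
    using h by (intro distr_PiM_reindex prob_space_axioms) (auto simp: bij_betw_def)
  have [measurable]: "{x \<in> space ?P. separated B (S - B) x} \<in> sets ?P"
    using B by measurable
  have "measure ?P {x \<in> space ?P. separated B (S - B) x}
      = measure (distr ?P ?P ?t) {x \<in> space ?P. separated B (S - B) x}"
    by (simp only: D)
  also have "\<dots> = measure ?P (?t -` {x \<in> space ?P. separated B (S - B) x} \<inter> space ?P)"
    by (intro measure_distr) measurable
  also have "?t -` {x \<in> space ?P. separated B (S - B) x} \<inter> space ?P = {x \<in> space ?P. separated B' (S - B') x}"
  proof -
    have "separated B (S - B) (?t x) \<longleftrightarrow> separated (h ` B) (h ` (S - B)) x" for x
      using B by (auto simp: separated_def subset_iff)
    moreover have "?t x \<in> space ?P" if "x \<in> space ?P" for x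
      using measurable_space[OF t that] .
    ultimately show ?thesis
      unfolding hB hC by blast
  qed
  finally show ?thesis .
qed

section \<open>Collision probability and its asymptotics\<close>

definition collision :: "nat \<Rightarrow> nat \<Rightarrow> (nat \<Rightarrow> real ^ 'k) \<Rightarrow> bool" where
  "collision a b x \<longleftrightarrow> (\<forall>i j. random_projection_hash a b x (axis i 1) = random_projection_hash a b x (axis j 1))"

text \<open>A finite union over the candidate hash sets replaces an equality between definite
  descriptions. This form yields measurability and is the one decomposed in
  \<open>collision_prob\<close>.\<close>

lemma collision_iff:
  "collision a b x \<longleftrightarrow> (\<exists>A\<in>{A. A \<subseteq> {1..a + b} \<and> card A = a}.
     \<forall>i. \<forall>n\<in>A. \<forall>m\<in>{1..a + b} - A. projection_before x (axis i 1) n m)"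
proof
  assume coll: "collision a b x"
  define A where "A = random_projection_hash a b x (axis undefined 1)"
  have A: "random_projection_hash a b x (axis i 1) = A" for i
    using coll unfolding collision_def A_def by blast
  have "A \<subseteq> {1..a + b}" "card A = a"
    unfolding A_def by (rule random_projection_hash_spec)+
  moreover have "projection_before x (axis i 1) n m" if "n \<in> A" "m \<in> {1..a + b} - A" for i n m
    using random_projection_hash_spec(3)[of n a b x "axis i 1" m] that unfolding A by blast
  ultimately show "\<exists>A\<in>{A. A \<subseteq> {1..a + b} \<and> card A = a}.
     \<forall>i. \<forall>n\<in>A. \<forall>m\<in>{1..a + b} - A. projection_before x (axis i 1) n m"
    by blast
next
  assume "\<exists>A\<in>{A. A \<subseteq> {1..a + b} \<and> card A = a}.
     \<forall>i. \<forall>n\<in>A. \<forall>m\<in>{1..a + b} - A. projection_before x (axis i 1) n m"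
  then obtain A where "A \<subseteq> {1..a + b}" "card A = a"
    "\<And>i n m. n \<in> A \<Longrightarrow> m \<in> {1..a + b} - A \<Longrightarrow> projection_before x (axis i 1) n m"
    by blast
  then have "random_projection_hash a b x (axis i 1) = A" for i
    by (intro random_projection_hash_eqI) auto
  then show "collision a b x"
    unfolding collision_def by simp
qed

lemma measurable_collision [measurable]:
  "Measurable.pred (PiM {1..a + b} (\<lambda>_. N)) (collision a b)"
proof -
  have "Measurable.pred (PiM {1..a + b} (\<lambda>_. N)) (\<lambda>x. projection_before x (axis i 1) n m)"
    if "A \<subseteq> {1..a + b}" "n \<in> A" "m \<in> {1..a + b} - A" for A i n m
  proof -
    have "n \<in> {1..a + b}" "m \<in> {1..a + b}"
      using that by auto
    moreover have "projection_before x (axis i 1) n m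
        \<longleftrightarrow> (if n < m then \<bar>x m $ i\<bar> \<le> \<bar>x n $ i\<bar> else \<bar>x m $ i\<bar> < \<bar>x n $ i\<bar>)" for x :: "nat \<Rightarrow> real ^ 'k"
      by (auto simp: projection_before_def inner_axis)
    ultimately show ?thesis
      by (cases "n < m") (simp_all only: if_True if_False measurable_compare_components)
  qed
  then show ?thesis
    unfolding collision_iff[abs_def]
    by (intro pred_intros_finite(4) pred_intros_countable(1) pred_intros_countable_bounded(3)) auto
qed

text \<open>Away from ties, a collision with common hash set \<open>A\<close> means that the
  complement of \<open>A\<close> is separated from \<open>A\<close>. The events belonging to
  different complements are disjoint and equally likely.\<close>

lemma collision_prob:
  "measure (PiM {1..a + b} (\<lambda>_. N)) {x \<in> space (PiM {1..a + b} (\<lambda>_. N)). collision a b x}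
   = real ((a + b) choose b) * measure (PiM {1..a + b} (\<lambda>_. N))
       {x \<in> space (PiM {1..a + b} (\<lambda>_. N)). separated {1..b} ({1..a + b} - {1..b}) x}"
proof -
  let ?S = "{1..a + b}"
  let ?P = "PiM ?S (\<lambda>_. N)"
  let ?BB = "{B. B \<subseteq> ?S \<and> card B = b}"
  let ?E = "\<lambda>B. {x \<in> space ?P. separated B (?S - B) x}"
  interpret P: prob_space ?P
    by (intro prob_space_PiM prob_space_axioms)
  have E [measurable]: "?E B \<in> sets ?P" if "B \<in> ?BB" for B
    using that by (intro predE measurable_separated) auto
  have iff: "collision a b x \<longleftrightarrow> (\<exists>B\<in>?BB. separated B (?S - B) x)"
    if x: "\<forall>i. \<forall>n\<in>?S. \<forall>m\<in>?S - {n}. \<bar>x n $ i\<bar> \<noteq> \<bar>x m $ i\<bar>" for x :: "nat \<Rightarrow> real ^ 'k"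
  proof
    assume "collision a b x"
    then obtain A where A: "A \<subseteq> ?S" "card A = a"
      "\<And>i n m. n \<in> A \<Longrightarrow> m \<in> ?S - A \<Longrightarrow> projection_before x (axis i 1) n m"
      unfolding collision_iff by blast
    have "separated (?S - A) (?S - (?S - A)) x"
      unfolding separated_def
    proof (intro allI ballI)
      fix i n m assume nm: "n \<in> ?S - A" "m \<in> ?S - (?S - A)"
      then have "m \<in> A" "n \<in> ?S" "m \<in> ?S - {n}"
        by auto
      then have "projection_before x (axis i 1) m n" "\<bar>x n $ i\<bar> \<noteq> \<bar>x m $ i\<bar>"
        using A(3) x nm by blast+
      then show "\<bar>x n $ i\<bar> < \<bar>x m $ i\<bar>"
        by (auto simp: projection_before_def inner_axis)
    qed
    moreover have "card (?S - A) = b"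
      using A by (simp add: card_Diff_subset finite_subset[OF A(1)])
    ultimately show "\<exists>B\<in>?BB. separated B (?S - B) x"
      by blast
  next
    assume "\<exists>B\<in>?BB. separated B (?S - B) x"
    then obtain B where B: "B \<subseteq> ?S" "card B = b" "separated B (?S - B) x"
      by blast
    have "card (?S - B) = a"
      using B by (simp add: card_Diff_subset finite_subset[OF B(1)])
    moreover have "projection_before x (axis i 1) n m" if "n \<in> ?S - B" "m \<in> ?S - (?S - B)" for i n m
      using B that by (auto simp: separated_def projection_before_def inner_axis)
    ultimately show "collision a b x"
      unfolding collision_iff by blast
  qed
  \<comment> \<open>Two distinct sets of equal size each contain an index missing from the other; of
    these two indices, each would need a strictly smaller projection than the other. The component
    \<open>undefined\<close> stands for an arbitrary one.\<close>
  have disj: "?E B \<inter> ?E B' = {}" if "B \<in> ?BB" "B' \<in> ?BB" "B \<noteq> B'" for B B'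
  proof -
    have "finite B" "finite B'"
      using that finite_subset[of _ ?S] by auto
    then have "\<not> B \<subseteq> B'" "\<not> B' \<subseteq> B"
      using that card_subset_eq[of B' B] card_subset_eq[of B B'] by auto
    then obtain n m where "n \<in> B" "n \<notin> B'" "m \<in> B'" "m \<notin> B"
      by blast
    moreover from this have "n \<in> ?S - B'" "m \<in> ?S - B"
      using that by auto
    ultimately have False if "separated B (?S - B) x" "separated B' (?S - B') x" for x
    proof -
      have "\<bar>x n $ undefined\<bar> < \<bar>x m $ undefined\<bar>"
        using that(1) \<open>n \<in> B\<close> \<open>m \<in> ?S - B\<close> unfolding separated_def by blast
      moreover have "\<bar>x m $ undefined\<bar> < \<bar>x n $ undefined\<bar>"
        using that(2) \<open>m \<in> B'\<close> \<open>n \<in> ?S - B'\<close> unfolding separated_def by blast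
      ultimately show False
        by simp
    qed
    then show ?thesis
      by blast
  qed
  have "measure ?P {x \<in> space ?P. collision a b x} = measure ?P (\<Union>B\<in>?BB. ?E B)"
  proof (rule P.finite_measure_eq_AE)
    show "AE x in ?P. x \<in> {x \<in> space ?P. collision a b x} \<longleftrightarrow> x \<in> (\<Union>B\<in>?BB. ?E B)"
    proof (rule eventually_mono[OF AE_no_tie[OF finite_atLeastAtMost]])
      fix x :: "nat \<Rightarrow> real ^ 'k" assume x: "\<forall>i. \<forall>n\<in>?S. \<forall>m\<in>?S - {n}. \<bar>x n $ i\<bar> \<noteq> \<bar>x m $ i\<bar>"
      show "x \<in> {x \<in> space ?P. collision a b x} \<longleftrightarrow> x \<in> (\<Union>B\<in>?BB. ?E B)"
        using iff[OF x] by blast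
    qed
    show "{x \<in> space ?P. collision a b x} \<in> sets ?P"
      by measurable
    show "(\<Union>B\<in>?BB. ?E B) \<in> sets ?P"
      by (intro sets.finite_UN E) auto
  qed
  also have "\<dots> = (\<Sum>B\<in>?BB. measure ?P (?E B))"
    using E disj by (intro P.finite_measure_finite_Union) (auto simp: disjoint_family_on_def)
  also have "\<dots> = (\<Sum>B\<in>?BB. measure ?P (?E {1..b}))"
    by (intro sum.cong refl separated_prob_exchangeable) auto
  also have "\<dots> = real ((a + b) choose b) * measure ?P (?E {1..b})"
    by (simp add: n_subsets)
  finally show ?thesis .
qed

lemma collision_prob_asymp:
  "(\<lambda>a. measure (PiM {1..a + b} (\<lambda>_. N)) {x \<in> space (PiM {1..a + b} (\<lambda>_. N)). collision a b x})
    \<sim>[at_top] (\<lambda>a. (K / c ^ CARD('k)) ^ b * real ((a + b) choose b) powi (- int CARD('k) + 1))"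
proof (cases "b = 0")
  case True
  \<comment> \<open>For \<open>b = 0\<close> the hash set is always all of \<open>{1..a + b}\<close>
    and a collision is certain. The moment argument below works with positive exponents.\<close>
  have "measure (PiM {1..a + b} (\<lambda>_. N)) {x \<in> space (PiM {1..a + b} (\<lambda>_. N)). collision a b x} = 1" for a
  proof -
    interpret P: prob_space "PiM {1..a + b} (\<lambda>_. N)"
      by (intro prob_space_PiM prob_space_axioms)
    have "collision a b x" for x
      unfolding collision_iff using True by (intro bexI[of _ "{1..a + b}"]) auto
    then show ?thesis
      using P.prob_space by simp
  qed
  then show ?thesis
    using True by simp
next
  case False
  define Q where "Q a = measure (PiM {1..a + b} (\<lambda>_. N))
       {x \<in> space (PiM {1..a + b} (\<lambda>_. N)). separated {1..b} ({1..a + b} - {1..b}) x}" for a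
  let ?D = "K / c ^ CARD('k)"
  have un: "({1..a + b} - {1..b}) \<union> {1..b} = {1..a + b}" for a
    by auto
  have cd: "card ({1..a + b} - {1..b}) = a" for a
    by (subst card_Diff_subset) auto
  have Q: "(\<lambda>a. real a ^ (CARD('k) * b) * Q a) \<longlonglongrightarrow> K ^ b * (fact b / c ^ b) ^ CARD('k)"
    unfolding Q_def by (rule separated_prob_tendsto[of b "\<lambda>a. {1..a + b} - {1..b}" "{1..b}", unfolded un])
      (use False cd in auto)
  \<comment> \<open>Of the \<open>k\<close> binomial factors one comes from
    \<open>collision_prob\<close>; the other \<open>k - 1\<close> come from dividing by the asserted
    asymptotic value.\<close>
  have "(\<lambda>a. (real ((a + b) choose b) / real a ^ b) ^ CARD('k) * (real a ^ (CARD('k) * b) * Q a) / ?D ^ b)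
      \<longlonglongrightarrow> (1 / fact b) ^ CARD('k) * (K ^ b * (fact b / c ^ b) ^ CARD('k)) / ?D ^ b"
    by (intro tendsto_intros Q binomial_add_tendsto) (use K_pos c_pos in auto)
  also have "(1 / fact b) ^ CARD('k) * (K ^ b * (fact b / c ^ b) ^ CARD('k)) / ?D ^ b = 1"
    using K_pos c_pos by (simp add: power_divide power_mult[symmetric] mult.commute)
  finally have lim: "(\<lambda>a. (real ((a + b) choose b) / real a ^ b) ^ CARD('k) * (real a ^ (CARD('k) * b) * Q a) / ?D ^ b)
      \<longlonglongrightarrow> 1" .
  show ?thesis
    unfolding collision_prob Q_def[symmetric]
  proof (rule asymp_equivI', rule Lim_transform_eventually[OF lim])
    show "\<forall>\<^sub>F a in sequentially. (real ((a + b) choose b) / real a ^ b) ^ CARD('k) * (real a ^ (CARD('k) * b) * Q a) / ?D ^ b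
       = real ((a + b) choose b) * Q a / (?D ^ b * real ((a + b) choose b) powi (- int CARD('k) + 1))"
      using eventually_gt_at_top[of 0]
    proof eventually_elim
      case (elim a)
      let ?C = "real ((a + b) choose b)"
      have C: "0 < ?C"
        by (simp add: zero_less_binomial)
      have "?C powi (- int CARD('k) + 1) = ?C / ?C ^ CARD('k)"
        using power_int_diff[of ?C 1 "int CARD('k)"] C by simp
      then show ?case
        using elim C K_pos c_pos by (simp add: power_divide power_mult[symmetric] mult.commute field_simps)
    qed
  qed
qed

end

section \<open>Linear images of Lebesgue measure\<close>

text \<open>
  The library's formula for the measure of a linear image requires a well-ordered index type.
  The copy \<open>wo\<close> of a countable type carries the order of an enumeration.
\<close>

typedef 'a wo = "UNIV :: 'a set"
  morphisms of_wo to_wo by simp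

lemma of_wo_inject' [simp]: "of_wo i = of_wo j \<longleftrightarrow> i = j"
  by (rule of_wo_inject)

lemma to_wo_of_wo [simp]: "to_wo (of_wo i) = i" and of_wo_to_wo [simp]: "of_wo (to_wo j) = j"
  by (simp_all add: of_wo_inverse to_wo_inverse)

lemma bij_of_wo: "bij of_wo"
  by (rule bij_betw_byWitness[where f' = to_wo]) auto

instance wo :: (finite) finite
proof
  have "(UNIV :: 'a wo set) = to_wo ` UNIV"
    by (metis surjI to_wo_of_wo)
  then show "finite (UNIV :: 'a wo set)"
    by (metis finite finite_imageI)
qed

instantiation wo :: (countable) wellorder
begin

definition less_eq_wo :: "'a wo \<Rightarrow> 'a wo \<Rightarrow> bool" where
  "less_eq_wo i j \<longleftrightarrow> to_nat (of_wo i) \<le> to_nat (of_wo j)"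

definition less_wo :: "'a wo \<Rightarrow> 'a wo \<Rightarrow> bool" where
  "less_wo i j \<longleftrightarrow> to_nat (of_wo i) < to_nat (of_wo j)"

instance
proof
  fix P :: "'a wo \<Rightarrow> bool" and i
  assume step: "\<And>i. (\<And>j. j < i \<Longrightarrow> P j) \<Longrightarrow> P i"
  show "P i"
    by (induction i rule: measure_induct_rule[where f = "\<lambda>i. to_nat (of_wo i)"])
      (auto simp: less_wo_def intro: step)
qed (auto simp: less_eq_wo_def less_wo_def)

end

lemma sum_of_wo: "(\<Sum>i\<in>UNIV. f (of_wo i)) = (\<Sum>i\<in>UNIV. f i)" for f :: "'a::finite \<Rightarrow> 'b::comm_monoid_add"
  by (rule sum.reindex_bij_betw[OF bij_of_wo])

lemma prod_of_wo: "(\<Prod>i\<in>UNIV. f (of_wo i)) = (\<Prod>i\<in>UNIV. f i)" for f :: "'a::finite \<Rightarrow> 'b::comm_monoid_mult"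
  by (rule prod.reindex_bij_betw[OF bij_of_wo])

definition vec_wo :: "'a ^ 'n \<Rightarrow> 'a ^ 'n wo" where
  "vec_wo x = (\<chi> i. x $ of_wo i)"

definition vec_un_wo :: "'a ^ 'n wo \<Rightarrow> 'a ^ 'n" where
  "vec_un_wo x = (\<chi> i. x $ to_wo i)"

lemma vec_un_wo_vec_wo [simp]: "vec_un_wo (vec_wo x) = x" and vec_wo_vec_un_wo [simp]: "vec_wo (vec_un_wo y) = y"
  by (simp_all add: vec_wo_def vec_un_wo_def vec_eq_iff)

lemma prod_Basis_vec: "(\<Prod>b\<in>(Basis :: (real ^ 'n) set). f b) = (\<Prod>i\<in>UNIV. f (axis i 1))"
proof -
  have B: "(Basis :: (real ^ 'n) set) = (\<lambda>i. axis i 1) ` UNIV"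
    by (auto simp: Basis_vec_def)
  have "inj (\<lambda>i::'n. axis i (1::real))"
    by (auto simp: inj_on_def axis_eq_axis)
  then show ?thesis
    unfolding B by (simp add: prod.reindex)
qed

lemma measurable_vec_lambda:
  assumes "\<And>i. (\<lambda>x. f x i) \<in> borel_measurable M"
  shows "(\<lambda>x. (\<chi> i. f x i) :: real ^ 'n) \<in> borel_measurable M"
  using assms by (subst borel_measurable_euclidean_space) (auto simp: Basis_vec_def inner_axis)

lemma measurable_vec_un_wo [measurable]: "(vec_un_wo :: real ^ 'n wo \<Rightarrow> real ^ 'n) \<in> borel_measurable borel"
  unfolding vec_un_wo_def[abs_def] by (intro measurable_vec_lambda) measurable

text \<open>Lebesgue measure is determined by its values on boxes, and reindexing takes a box to a
  box with the same side lengths.\<close>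

lemma distr_vec_un_wo: "distr lborel borel vec_un_wo = (lborel :: (real ^ 'n) measure)"
proof (rule lborel_eqI[symmetric])
  fix l u :: "real ^ 'n" assume "\<And>b. b \<in> Basis \<Longrightarrow> l \<bullet> b \<le> u \<bullet> b"
  then have "l \<bullet> axis i 1 \<le> u \<bullet> axis i 1" for i
    by (auto simp: Basis_vec_def)
  then have lu: "l $ i \<le> u $ i" for i
    by (simp add: inner_axis)
  have "vec_un_wo x \<in> box l u \<longleftrightarrow> x \<in> box (vec_wo l) (vec_wo u)" for x
    by (simp add: mem_box_cart vec_un_wo_def vec_wo_def) (metis of_wo_to_wo to_wo_of_wo)
  then have "emeasure (distr lborel borel vec_un_wo) (box l u) = emeasure lborel (box (vec_wo l) (vec_wo u))"
    by (subst emeasure_distr) (auto intro!: arg_cong[where f = "emeasure lborel"])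
  also have "\<dots> = (\<Prod>b\<in>Basis. (vec_wo u - vec_wo l) \<bullet> b)"
    using lu by (subst emeasure_lborel_box_eq) (auto simp: Basis_vec_def inner_axis vec_wo_def)
  also have "\<dots> = (\<Prod>b\<in>Basis. (u - l) \<bullet> b)"
    using prod_of_wo[of "\<lambda>i. u $ i - l $ i"] by (simp add: prod_Basis_vec inner_axis vec_wo_def)
  finally show "emeasure (distr lborel borel vec_un_wo) (box l u) = (\<Prod>b\<in>Basis. (u - l) \<bullet> b)" .
qed simp

lemma vec_wo_image: "vec_wo ` S = vec_un_wo -` S"
  by (auto simp: image_iff) (metis vec_wo_vec_un_wo)

lemma emeasure_vec_wo_image:
  fixes S :: "(real ^ 'n) set"
  assumes [measurable]: "S \<in> sets borel"
  shows "vec_wo ` S \<in> sets borel" "emeasure lborel (vec_wo ` S) = emeasure lborel S"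
proof -
  have "vec_un_wo -` S \<inter> space borel \<in> sets borel"
    by measurable
  then show "vec_wo ` S \<in> sets borel"
    by (simp add: vec_wo_image)
  have "emeasure (distr lborel borel vec_un_wo) S = emeasure lborel (vec_wo ` S)"
    by (subst emeasure_distr) (auto simp: vec_wo_image)
  then show "emeasure lborel (vec_wo ` S) = emeasure lborel S"
    by (simp add: distr_vec_un_wo)
qed

definition mat_wo :: "real ^ 'n ^ 'n \<Rightarrow> real ^ 'n wo ^ 'n wo" where
  "mat_wo A = (\<chi> i j. A $ of_wo i $ of_wo j)"

text \<open>The determinant is taken on the reindexed copy because
  \<open>measure_linear_image\<close> is applied there. Rows and columns are reindexed alike, so the
  value is the usual absolute determinant.\<close>

definition absdet :: "real ^ 'n ^ 'n \<Rightarrow> real" where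
  "absdet A = \<bar>det (mat_wo A)\<bar>"

lemma absdet_nonneg: "0 \<le> absdet A"
  by (simp add: absdet_def)

lemma vec_wo_mult: "vec_wo (A *v x) = mat_wo A *v vec_wo x"
  using sum_of_wo[of "\<lambda>j. A $ i $ j * x $ j" for i]
  by (simp add: vec_eq_iff vec_wo_def mat_wo_def matrix_vector_mult_def)

lemma absdet_mult: "absdet (A ** B) = absdet A * absdet B"
proof -
  have "mat_wo (A ** B) = mat_wo A ** mat_wo B"
    using sum_of_wo[of "\<lambda>k. A $ i $ k * B $ k $ j" for i j]
    by (simp add: vec_eq_iff mat_wo_def matrix_matrix_mult_def)
  then show ?thesis
    by (simp add: absdet_def det_mul abs_mult)
qed

lemma absdet_mat_1: "absdet (mat 1 :: real ^ 'n ^ 'n) = 1"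
proof -
  have "mat_wo (mat 1) = (mat 1 :: real ^ 'n wo ^ 'n wo)"
    by (simp add: vec_eq_iff mat_wo_def mat_def)
  then show ?thesis
    by (simp add: absdet_def)
qed

lemma absdet_transpose: "absdet (transpose A) = absdet A"
proof -
  have "mat_wo (transpose A) = transpose (mat_wo A)"
    by (simp add: vec_eq_iff mat_wo_def transpose_def)
  then show ?thesis
    by (simp add: absdet_def)
qed

text \<open>The map \<open>vec_wo\<close> preserves Lebesgue measure and intertwines
  \<open>A\<close> with \<open>mat_wo A\<close>, so the formula is carried over from the
  well-ordered copy.\<close>

lemma measure_matrix_image:
  fixes A :: "real ^ 'n ^ 'n"
  assumes S: "S \<in> sets borel" "emeasure lborel S \<noteq> \<infinity>" and AS: "(*v) A ` S \<in> sets borel"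
  shows "emeasure lborel ((*v) A ` S) = ennreal (absdet A * measure lborel S)"
proof -
  have fin: "vec_wo ` S \<in> lmeasurable"
    using emeasure_vec_wo_image[OF S(1)] S(2) by (intro fmeasurableI) (auto simp: top.not_eq_extremum)
  have lin: "linear ((*v) (mat_wo A))"
    by simp
  have img: "vec_wo ` (*v) A ` S = (*v) (mat_wo A) ` vec_wo ` S"
    by (auto simp: vec_wo_mult image_image)
  have "emeasure lborel ((*v) A ` S) = emeasure lborel (vec_wo ` (*v) A ` S)"
    using emeasure_vec_wo_image[OF AS] by simp
  also have "\<dots> = emeasure lebesgue ((*v) (mat_wo A) ` vec_wo ` S)"
    using emeasure_vec_wo_image(1)[OF AS] by (simp add: img)
  also have "\<dots> = ennreal (measure lebesgue ((*v) (mat_wo A) ` vec_wo ` S))"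
    by (rule emeasure_eq_measure2[OF measurable_linear_image[OF lin fin]])
  also have "\<dots> = ennreal (absdet A * measure lebesgue (vec_wo ` S))"
    by (simp add: measure_linear_image[OF lin fin] absdet_def)
  also have "measure lebesgue (vec_wo ` S) = measure lborel S"
    using emeasure_vec_wo_image[OF S(1)] by (simp add: measure_def)
  finally show ?thesis .
qed

section \<open>The standard Gaussian measure\<close>

lemma inner_axis_right: "x \<bullet> axis i (1::real) = x $ i"
  by (simp add: inner_axis)

text \<open>After undoing the rotation \<open>U\<close>, taking inner products with the vectors
  \<open>T (axis j 1)\<close> amounts to selecting coordinates. Rotation invariance of the Gaussian
  law and its product form can then be used separately.\<close>

lemma linear_isometry_extends:
  fixes T :: "real ^ 'k \<Rightarrow> real ^ 'd"
  assumes T: "linear T" "\<And>x. norm (T x) = norm x"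
  shows "\<exists>(\<sigma> :: 'k \<Rightarrow> 'd) (U :: real ^ 'd \<Rightarrow> real ^ 'd). inj \<sigma> \<and> orthogonal_transformation U \<and> (\<forall>j. U (axis (\<sigma> j) 1) = T (axis j 1))"
proof -
  have inj_norm: "inj f" if "linear f" "\<And>x. norm (f x) = norm x" for f :: "real ^ 'k \<Rightarrow> real ^ 'd"
    unfolding linear_injective_0[OF that(1)] using that(2) by (metis norm_eq_zero)
  have dimT: "dim (range T) = CARD('k)"
    using dim_image_eq[OF T(1), of UNIV] inj_norm[OF T] by simp
  then have "CARD('k) \<le> CARD('d)"
    using dim_subset_UNIV[of "range T"] by simp
  then obtain \<sigma> :: "'k \<Rightarrow> 'd" where \<sigma>: "inj \<sigma>"
    using card_le_inj[of "UNIV :: 'k set" "UNIV :: 'd set"] by auto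
  \<comment> \<open>\<open>E\<close> embeds along the coordinates chosen by \<sigma>, and
    \<open>P\<close> is both its adjoint and its left inverse, so \<open>E (P x)\<close> is the
    orthogonal projection of \<open>x\<close> on the range of \<open>E\<close>.\<close>
  define E :: "real ^ 'k \<Rightarrow> real ^ 'd" where "E x = (\<Sum>j\<in>UNIV. x $ j *\<^sub>R axis (\<sigma> j) 1)" for x
  define P :: "real ^ 'd \<Rightarrow> real ^ 'k" where "P x = (\<chi> j. x $ \<sigma> j)" for x
  have E: "linear E"
    unfolding E_def by (intro linearI) (auto simp: scaleR_add_left sum.distrib scaleR_sum_right)
  have P: "linear P"
    unfolding P_def by (intro linearI) (auto simp: vec_eq_iff)
  have adj: "E z \<bullet> y = z \<bullet> P y" for z y
    unfolding E_def P_def by (simp add: inner_sum_left inner_axis' inner_vec_def[of z])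
  have PE: "P (E z) = z" for z
    unfolding E_def P_def using \<sigma>
    by (auto simp: vec_eq_iff axis_def inj_eq if_distrib[of "\<lambda>u. _ * u"] cong: if_cong)
  have normE: "norm (E z) = norm z" for z
    by (simp add: norm_eq_sqrt_inner adj PE)
  define S' where "S' = {y \<in> UNIV. \<forall>x\<in>range E. orthogonal x y}"
  define R' where "R' = {y \<in> UNIV. \<forall>x\<in>range T. orthogonal x y}"
  have sub: "subspace (range E)" "subspace (range T)"
    using E T(1) by (auto intro: linear_subspace_image)
  have "dim S' + dim (range E) = DIM(real ^ 'd)" "dim R' + dim (range T) = DIM(real ^ 'd)"
    unfolding S'_def R'_def using sub
    by (subst dim_subspace_orthogonal_to_vectors; simp)+
  moreover have "dim (range E) = CARD('k)"
    using dim_image_eq[OF E, of UNIV] inj_norm[OF E normE] by simp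
  ultimately have dim: "dim S' = dim R'"
    using dimT by simp
  have sub': "subspace S'" "subspace R'"
    unfolding S'_def R'_def by (auto simp: subspace_def orthogonal_def inner_add_right)
  obtain f where f: "linear f" "f ` S' = R'" "\<And>x. x \<in> S' \<Longrightarrow> norm (f x) = norm x"
    using isometries_subspaces[OF sub' dim] by metis
  have res: "x - E (P x) \<in> S'" for x
    unfolding S'_def by (auto simp: orthogonal_def adj linear_diff[OF P] PE)
  \<comment> \<open>\<open>T\<close> transported to the range of \<open>E\<close>, plus an isometry
    between the orthogonal complements of the ranges of \<open>E\<close> and \<open>T\<close>, which
    have equal dimension. Pythagoras on both sides shows that norms are preserved.\<close>
  define U where "U x = T (P x) + f (x - E (P x))" for x
  have "norm (U x) = norm x" for x
  proof -
    have "orthogonal (T (P x)) (f (x - E (P x)))"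
      using f(2) res[of x] unfolding R'_def by blast
    then have "(norm (U x))\<^sup>2 = (norm (P x))\<^sup>2 + (norm (x - E (P x)))\<^sup>2"
      unfolding U_def by (simp add: norm_add_Pythagorean T f(3)[OF res])
    also have "\<dots> = (norm (E (P x) + (x - E (P x))))\<^sup>2"
      using res[of x] by (subst norm_add_Pythagorean) (auto simp: S'_def normE)
    finally show ?thesis
      by simp
  qed
  moreover have "linear U"
    using linear_compose_add[OF linear_compose[OF P T(1)]
        linear_compose[OF linear_compose_sub[OF linear_ident linear_compose[OF P E]] f(1)]]
    by (simp add: U_def[abs_def] o_def)
  ultimately have "orthogonal_transformation U"
    by (simp add: orthogonal_transformation)
  moreover have "U (axis (\<sigma> j) 1) = T (axis j 1)" for j
  proof -
    have "axis (\<sigma> j) 1 = E (axis j 1)"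
      unfolding E_def by (simp add: axis_def if_distrib[of "\<lambda>u. u *\<^sub>R _"] cong: if_cong)
    then show ?thesis
      by (simp add: U_def PE linear_0[OF f(1)])
  qed
  ultimately show ?thesis
    using \<sigma> by blast
qed

section \<open>Gaussian vectors: product form, density and invariance\<close>

abbreviation std_normal :: "real measure" where
  "std_normal \<equiv> density lborel (\<lambda>x. ennreal (std_normal_density x))"

interpretation std_normal: prob_space std_normal
  by (rule prob_space_normal_density) simp

definition gauss :: "(real ^ 'n) measure" where
  "gauss = distr (PiM UNIV (\<lambda>_. std_normal)) borel (\<lambda>f. \<chi> i. f i)"

lemma sets_gauss [simp, measurable_cong]: "sets gauss = sets borel"
  by (simp add: gauss_def)

lemma space_gauss [simp]: "space gauss = UNIV"
  by (simp add: gauss_def)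

lemma measurable_vec_PiM [measurable]:
  "(\<lambda>f. (\<chi> i. f i) :: real ^ 'n) \<in> borel_measurable (PiM UNIV (\<lambda>_. std_normal))"
  by (intro measurable_vec_lambda) measurable

lemma prob_space_gauss: "prob_space gauss"
  unfolding gauss_def
  by (intro prob_space.prob_space_distr prob_space_PiM std_normal.prob_space_axioms measurable_vec_PiM)

lemma distr_eq_gaussI:
  fixes X :: "'m \<Rightarrow> real ^ 'n"
  assumes "prob_space M" and ind: "prob_space.indep_vars M (\<lambda>_. borel) (\<lambda>c \<omega>. X \<omega> $ c) UNIV"
    and X: "\<And>c. distributed M lborel (\<lambda>\<omega>. X \<omega> $ c) std_normal_density"
  shows "distr M borel X = gauss"
proof -
  interpret prob_space M by fact
  have [measurable]: "(\<lambda>\<omega>. X \<omega> $ c) \<in> borel_measurable M" for c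
    using distributed_measurable[OF X] by simp
  have "distr M (\<Pi>\<^sub>M i\<in>UNIV. borel) (\<lambda>\<omega>. \<lambda>i\<in>UNIV. X \<omega> $ i) = (\<Pi>\<^sub>M i\<in>UNIV. distr M borel (\<lambda>\<omega>. X \<omega> $ i))"
    using ind by (subst (asm) indep_vars_iff_distr_eq_PiM) auto
  moreover have "distr M borel (\<lambda>\<omega>. X \<omega> $ i) = std_normal" for i
    using distributed_distr_eq_density[OF X[of i]] by (simp cong: distr_cong)
  ultimately have eq: "distr M (\<Pi>\<^sub>M i\<in>UNIV. borel) (\<lambda>\<omega>. \<lambda>i\<in>UNIV. X \<omega> $ i) = (\<Pi>\<^sub>M i\<in>UNIV. std_normal)"
    by simp
  have "gauss = distr (distr M (\<Pi>\<^sub>M i\<in>UNIV. borel) (\<lambda>\<omega>. \<lambda>i\<in>UNIV. X \<omega> $ i)) borel (\<lambda>f. \<chi> i. f i)"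
    by (simp add: eq gauss_def)
  also have "\<dots> = distr M borel ((\<lambda>f. \<chi> i. f i) \<circ> (\<lambda>\<omega>. \<lambda>i\<in>UNIV. X \<omega> $ i))"
    by (intro distr_distr measurable_vec_lambda) measurable
  also have "(\<lambda>f. \<chi> i. f i) \<circ> (\<lambda>\<omega>. \<lambda>i\<in>UNIV. X \<omega> $ i) = X"
    by (auto simp: fun_eq_iff vec_eq_iff)
  finally show ?thesis ..
qed

definition gauss_density :: "real ^ 'n \<Rightarrow> real" where
  "gauss_density x = (1 / sqrt (2 * pi)) ^ CARD('n) * exp (- (norm x)\<^sup>2 / 2)"

lemma gauss_density_prod: "gauss_density x = (\<Prod>i\<in>UNIV. std_normal_density (x $ i))"
proof -
  have "(norm x)\<^sup>2 = (\<Sum>i\<in>UNIV. (x $ i)\<^sup>2)"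
    by (simp add: norm_vec_def L2_set_def sum_nonneg)
  then show ?thesis
    by (simp add: gauss_density_def std_normal_density_def prod.distrib exp_sum[symmetric]
        sum_negf sum_divide_distrib power_divide prod_dividef)
qed

lemma measurable_gauss_density [measurable]: "gauss_density \<in> borel_measurable borel"
  unfolding gauss_density_def[abs_def] by measurable

text \<open>The product form serves for coordinates and independence, the density for rotation
  invariance and for small boxes. The comparison is made on product sets, after the density measure
  has been carried to the function space.\<close>

lemma gauss_eq_density: "gauss = density lborel (\<lambda>x :: real ^ 'n. ennreal (gauss_density x))"
proof -
  interpret product_prob_space "\<lambda>_. std_normal" "UNIV :: 'n set"
    by unfold_locales
  let ?D = "density lborel (\<lambda>x :: real ^ 'n. ennreal (gauss_density x))"
  let ?p = "\<lambda>x :: real ^ 'n. \<lambda>i\<in>UNIV. x $ i"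
  have p [measurable]: "?p \<in> measurable borel (PiM UNIV (\<lambda>_. std_normal))"
    by (intro measurable_restrict) measurable
  have "distr ?D (PiM UNIV (\<lambda>_. std_normal)) ?p = PiM UNIV (\<lambda>_. std_normal)"
  proof (rule PiM_eqI)
    fix A :: "'n \<Rightarrow> real set" assume "\<And>i. i \<in> UNIV \<Longrightarrow> A i \<in> sets std_normal"
    then have A [measurable]: "A i \<in> sets borel" for i
      by simp
    have PA: "PiE UNIV A \<in> sets (PiM UNIV (\<lambda>_. std_normal))"
      by (intro sets_PiM_I_finite) auto
    have "emeasure (distr ?D (PiM UNIV (\<lambda>_. std_normal)) ?p) (PiE UNIV A) = emeasure ?D (?p -` PiE UNIV A \<inter> space ?D)"
      using PA by (intro emeasure_distr) auto
    also have "?p -` PiE UNIV A \<inter> space ?D = {x. \<forall>i. x $ i \<in> A i}"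
      by auto
    also have "emeasure ?D {x. \<forall>i. x $ i \<in> A i}
        = (\<integral>\<^sup>+x. ennreal (gauss_density x) * indicator {x. \<forall>i. x $ i \<in> A i} x \<partial>lborel)"
    proof (intro emeasure_density)
      have "{x \<in> space borel. \<forall>i. x $ i \<in> A i} \<in> sets borel"
        by measurable
      then show "{x. \<forall>i. x $ i \<in> A i} \<in> sets lborel"
        by simp
    qed measurable
    also have "\<dots> = (\<integral>\<^sup>+x. (\<Prod>i\<in>UNIV. ennreal (std_normal_density (x $ i)) * indicator (A i) (x $ i)) \<partial>lborel)"
    proof (rule nn_integral_cong)
      fix x :: "real ^ 'n"
      have "(indicator {x. \<forall>i. x $ i \<in> A i} x :: ennreal) = (\<Prod>i\<in>UNIV. indicator (A i) (x $ i))"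
        by (auto simp: indicator_def prod_zero_iff)
      then show "ennreal (gauss_density x) * indicator {x. \<forall>i. x $ i \<in> A i} x
        = (\<Prod>i\<in>UNIV. ennreal (std_normal_density (x $ i)) * indicator (A i) (x $ i))"
        by (simp add: gauss_density_prod prod.distrib prod_ennreal)
    qed
    also have "\<dots> = (\<Prod>i\<in>UNIV. \<integral>\<^sup>+s. ennreal (std_normal_density s) * indicator (A i) s \<partial>lborel)"
      by (intro nn_integral_lborel_vec_prod) measurable
    also have "\<dots> = (\<Prod>i\<in>UNIV. emeasure std_normal (A i))"
      by (simp add: emeasure_density)
    finally show "emeasure (distr ?D (PiM UNIV (\<lambda>_. std_normal)) ?p) (PiE UNIV A) = (\<Prod>i\<in>UNIV. emeasure std_normal (A i))" .
  qed auto
  then have "gauss = distr (distr ?D (PiM UNIV (\<lambda>_. std_normal)) ?p) borel (\<lambda>f. \<chi> i. f i)"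
    by (simp add: gauss_def)
  also have "\<dots> = distr ?D borel ((\<lambda>f. \<chi> i. f i) \<circ> ?p)"
    by (intro distr_distr) auto
  also have "(\<lambda>f. \<chi> i. f i) \<circ> ?p = (\<lambda>x. x)"
    by (auto simp: fun_eq_iff vec_eq_iff)
  also have "distr ?D borel (\<lambda>x. x) = ?D"
    by (rule distr_id2) simp
  finally show ?thesis .
qed

lemma linear_borel_measurable:
  fixes f :: "'a::euclidean_space \<Rightarrow> 'b::euclidean_space"
  shows "linear f \<Longrightarrow> f \<in> borel_measurable borel"
  by (intro borel_measurable_continuous_onI linear_continuous_on) (simp add: linear_conv_bounded_linear)

lemma orthogonal_transformation_borel:
  fixes U :: "real ^ 'n \<Rightarrow> real ^ 'n"
  shows "orthogonal_transformation U \<Longrightarrow> U \<in> borel_measurable borel"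
  by (intro linear_borel_measurable orthogonal_transformation_linear)

text \<open>The preimage of a box under \<open>U\<close> is its image under \<open>inv U\<close>,
  whose matrix has absolute determinant 1 because its product with its transpose is the
  identity.\<close>

lemma distr_lborel_orthogonal:
  fixes U :: "real ^ 'n \<Rightarrow> real ^ 'n"
  assumes U: "orthogonal_transformation U"
  shows "distr lborel borel U = lborel"
proof (rule lborel_eqI[symmetric])
  have meas [measurable]: "U \<in> borel_measurable borel"
    by (rule orthogonal_transformation_borel[OF U])
  fix l u :: "real ^ 'n" assume lu: "\<And>b. b \<in> Basis \<Longrightarrow> l \<bullet> b \<le> u \<bullet> b"
  let ?A = "matrix (inv U)"
  have V: "orthogonal_transformation (inv U)"
    by (rule orthogonal_transformation_inv[OF U])
  then have "transpose ?A ** ?A = mat 1"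
    by (simp add: orthogonal_transformation_matrix orthogonal_matrix)
  then have "absdet ?A * absdet ?A = 1"
    by (metis absdet_mult absdet_transpose absdet_mat_1)
  then have A1: "absdet ?A = 1"
    using absdet_nonneg[of ?A] by (simp add: square_eq_1_iff)
  have AV: "(*v) ?A = inv U"
    using V by (auto simp: fun_eq_iff orthogonal_transformation_linear matrix_works)
  have VU: "inv U ` S = U -` S" for S
    by (rule bij_vimage_eq_inv_image[symmetric]) (rule orthogonal_transformation_bij[OF U])
  have "U -` box l u \<inter> space borel \<in> sets borel"
    by measurable
  then have img: "(*v) ?A ` box l u \<in> sets borel"
    by (simp add: AV VU)
  have fin: "emeasure lborel (box l u) \<noteq> \<infinity>"
    using emeasure_lborel_box_finite[of l u] by auto
  have "emeasure (distr lborel borel U) (box l u) = emeasure lborel ((*v) ?A ` box l u)"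
    by (subst emeasure_distr) (auto simp: AV VU)
  also have "\<dots> = ennreal (measure lborel (box l u))"
    using measure_matrix_image[OF _ fin img] A1 by simp
  also have "\<dots> = emeasure lborel (box l u)"
    using fin by (intro emeasure_eq_ennreal_measure[symmetric]) simp
  finally show "emeasure (distr lborel borel U) (box l u) = (\<Prod>b\<in>Basis. (u - l) \<bullet> b)"
    using lu by (simp add: emeasure_lborel_box_eq)
qed simp

text \<open>Lebesgue measure is invariant, and the density depends on the norm alone.\<close>

lemma distr_gauss_orthogonal:
  fixes U :: "real ^ 'n \<Rightarrow> real ^ 'n"
  assumes U: "orthogonal_transformation U"
  shows "distr gauss borel U = gauss"
proof (rule measure_eqI)
  have [measurable]: "U \<in> borel_measurable borel"
    by (rule orthogonal_transformation_borel[OF U])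
  have inv: "gauss_density (U x) = gauss_density x" for x
    using U by (simp add: gauss_density_def orthogonal_transformation)
  fix A assume "A \<in> sets (distr gauss borel U)"
  then have [measurable]: "A \<in> sets borel"
    by simp
  have "emeasure (distr gauss borel U) A = emeasure gauss (U -` A \<inter> space borel)"
    by (subst emeasure_distr) auto
  also have "\<dots> = (\<integral>\<^sup>+x. ennreal (gauss_density x) * indicator (U -` A \<inter> space borel) x \<partial>lborel)"
    unfolding gauss_eq_density by (intro emeasure_density) measurable
  also have "\<dots> = (\<integral>\<^sup>+x. ennreal (gauss_density (U x)) * indicator A (U x) \<partial>lborel)"
    by (intro nn_integral_cong) (auto simp: inv indicator_def)
  also have "\<dots> = (\<integral>\<^sup>+x. ennreal (gauss_density x) * indicator A x \<partial>distr lborel borel U)"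
    by (subst nn_integral_distr) auto
  also have "\<dots> = emeasure gauss A"
    unfolding gauss_eq_density distr_lborel_orthogonal[OF U] by (intro emeasure_density[symmetric]) measurable
  finally show "emeasure (distr gauss borel U) A = emeasure gauss A" .
qed simp

lemma distr_gauss_coordinates:
  fixes \<sigma> :: "'k::finite \<Rightarrow> 'd::finite"
  assumes "inj \<sigma>"
  shows "distr gauss borel (\<lambda>x :: real ^ 'd. (\<chi> j. x $ \<sigma> j) :: real ^ 'k) = gauss"
proof -
  let ?Pd = "PiM (UNIV :: 'd set) (\<lambda>_. std_normal)" and ?Pk = "PiM (UNIV :: 'k set) (\<lambda>_. std_normal)"
  have "distr gauss borel (\<lambda>x :: real ^ 'd. (\<chi> j. x $ \<sigma> j) :: real ^ 'k)
      = distr ?Pd borel ((\<lambda>x. (\<chi> j. x $ \<sigma> j)) \<circ> (\<lambda>f. \<chi> i. f i))"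
    unfolding gauss_def by (intro distr_distr measurable_vec_lambda) measurable
  also have "(\<lambda>x. (\<chi> j. x $ \<sigma> j)) \<circ> (\<lambda>f. \<chi> i. f i) = (\<lambda>f. \<chi> i. f i) \<circ> (\<lambda>\<omega>. \<lambda>j\<in>UNIV. \<omega> (\<sigma> j) :: real)"
    by (auto simp: fun_eq_iff vec_eq_iff)
  also have "distr ?Pd borel \<dots> = distr (distr ?Pd ?Pk (\<lambda>\<omega>. \<lambda>j\<in>UNIV. \<omega> (\<sigma> j))) borel (\<lambda>f. \<chi> i. f i)"
    by (intro distr_distr[symmetric]) (auto intro!: measurable_restrict)
  also have "distr ?Pd ?Pk (\<lambda>\<omega>. \<lambda>j\<in>UNIV. \<omega> (\<sigma> j)) = ?Pk"
    using assms by (intro distr_PiM_reindex std_normal.prob_space_axioms) auto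
  finally show ?thesis
    by (simp add: gauss_def)
qed

lemma distr_gauss_isometry:
  fixes T :: "real ^ 'k \<Rightarrow> real ^ 'd"
  assumes T: "linear T" "\<And>x. norm (T x) = norm x"
  shows "distr gauss borel (\<lambda>r. (\<chi> j. r \<bullet> T (axis j 1)) :: real ^ 'k) = gauss"
proof -
  obtain \<sigma> :: "'k \<Rightarrow> 'd" and U :: "real ^ 'd \<Rightarrow> real ^ 'd" where \<sigma>: "inj \<sigma>" and U: "orthogonal_transformation U"
    and UT: "\<And>j. U (axis (\<sigma> j) 1) = T (axis j 1)"
    using linear_isometry_extends[OF T] by blast
  have V: "orthogonal_transformation (inv U)"
    by (rule orthogonal_transformation_inv[OF U])
  have "r \<bullet> T (axis j 1) = inv U r $ \<sigma> j" for r j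
  proof -
    have "r \<bullet> T (axis j 1) = U (inv U r) \<bullet> U (axis (\<sigma> j) 1)"
      using UT orthogonal_transformation_surj[OF U] by (simp add: surj_f_inv_f)
    also have "\<dots> = inv U r $ \<sigma> j"
      using U by (simp add: orthogonal_transformation_def inner_axis_right)
    finally show ?thesis .
  qed
  then have "distr gauss borel (\<lambda>r. (\<chi> j. r \<bullet> T (axis j 1)) :: real ^ 'k)
      = distr gauss borel ((\<lambda>x. \<chi> j. x $ \<sigma> j) \<circ> inv U)"
    by (simp add: comp_def)
  also have "\<dots> = distr (distr gauss borel (inv U)) borel (\<lambda>x. \<chi> j. x $ \<sigma> j)"
  proof (intro distr_distr[symmetric] measurable_vec_lambda)
    show "inv U \<in> measurable gauss borel"
      using orthogonal_transformation_borel[OF V] by simp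
  qed measurable
  also have "\<dots> = gauss"
    by (simp add: distr_gauss_orthogonal[OF V] distr_gauss_coordinates[OF \<sigma>])
  finally show ?thesis .
qed

section \<open>Gaussian measure of small parallelepipeds\<close>

interpretation gauss: prob_space gauss
  by (rule prob_space_gauss)

text \<open>The event is the image under \<open>B\<close> of a box, of volume
  \<open>(\<Prod>i. 2 * t $ i) / absdet W\<close>. On it the density is at most its value \<phi> at
  0, and at least \<phi> times \<open>1 - (norm z)\<^sup>2 / 2\<close>, by
  \<open>1 + x \<le> exp x\<close>.\<close>

lemma gauss_box_bounds:
  fixes W B :: "real ^ 'k ^ 'k"
  assumes BW: "B ** W = mat 1"
  defines "K \<equiv> (2 / sqrt (2 * pi)) ^ CARD('k) / absdet W"
    and "P \<equiv> \<lambda>t. measure gauss {z. \<forall>i. \<bar>(W *v z) $ i\<bar> < t $ i}"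
  shows "\<exists>C\<ge>0. \<forall>t. (\<forall>i. 0 \<le> t $ i) \<longrightarrow>
    K * (\<Prod>i\<in>UNIV. t $ i) * (1 - C * (\<Sum>i\<in>UNIV. (t $ i)\<^sup>2)) \<le> P t \<and> P t \<le> K * (\<Prod>i\<in>UNIV. t $ i)"
proof -
  define \<phi> where "\<phi> = (1 / sqrt (2 * pi)) ^ CARD('k)"
  have \<phi>: "0 < \<phi>"
    by (simp add: \<phi>_def)
  have WB: "W ** B = mat 1"
    using BW by (simp add: matrix_left_right_inverse)
  have det: "absdet B * absdet W = 1"
    using absdet_mult[of B W] by (simp add: BW absdet_mat_1)
  then have detB: "absdet B = 1 / absdet W"
    by (metis mult_eq_0_iff nonzero_eq_divide_eq zero_neq_one)
  obtain c where c: "c > 0" "\<And>x. norm (B *v x) \<le> c * norm x"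
    using linear_bounded_pos[of "(*v) B"] by auto
  \<comment> \<open>On the event \<open>norm z \<le> c * norm (W *v z)\<close>, and the components
    of \<open>W *v z\<close> are bounded by those of \<open>t\<close>; the 2 is that of the Gaussian
    exponent.\<close>
  define C where "C = c\<^sup>2 / 2"
  have bounds: "K * (\<Prod>i\<in>UNIV. t $ i) * (1 - C * (\<Sum>i\<in>UNIV. (t $ i)\<^sup>2)) \<le> P t \<and> P t \<le> K * (\<Prod>i\<in>UNIV. t $ i)"
    if t: "\<And>i. 0 \<le> t $ i" for t
  proof -
    define S where "S = {z. \<forall>i. \<bar>(W *v z) $ i\<bar> < t $ i}"
    have img: "S = (*v) B ` box (- t) t"
    proof (intro equalityI subsetI)
      fix z assume "z \<in> S"
      then have "W *v z \<in> box (- t) t"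
        by (auto simp: S_def mem_box_cart abs_less_iff) (metis minus_less_iff)+
      moreover have "z = B *v (W *v z)"
        by (simp add: matrix_vector_mul_assoc BW)
      ultimately show "z \<in> (*v) B ` box (- t) t"
        by blast
    next
      fix z assume "z \<in> (*v) B ` box (- t) t"
      then obtain y where "y \<in> box (- t) t" "z = B *v y"
        by blast
      then show "z \<in> S"
        by (auto simp: S_def mem_box_cart abs_less_iff matrix_vector_mul_assoc WB) (metis minus_less_iff)
    qed
    have [measurable]: "(*v) W \<in> borel_measurable borel"
      by (intro linear_borel_measurable) simp
    have "{z \<in> space borel. \<forall>i. \<bar>(W *v z) $ i\<bar> < t $ i} \<in> sets borel"
      by measurable
    then have S [measurable]: "S \<in> sets borel"
      by (simp add: S_def)
    define m where "m = absdet B * (\<Prod>i\<in>UNIV. 2 * t $ i)"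
    have m0: "0 \<le> m"
      using t by (simp add: m_def absdet_nonneg prod_nonneg)
    have box: "emeasure lborel (box (- t) t) = ennreal (\<Prod>i\<in>UNIV. 2 * t $ i)"
    proof -
      have "- t \<bullet> b \<le> t \<bullet> b" if "b \<in> Basis" for b
        using that t by (auto simp: Basis_vec_def inner_axis)
      moreover have "(t - - t) \<bullet> axis i 1 = 2 * t $ i" for i
        by (simp only: inner_axis_right vector_minus_component vector_uminus_component)
      ultimately show ?thesis
        using emeasure_lborel_box[of "- t" t] by (simp only: prod_Basis_vec)
    qed
    have vol: "emeasure lborel S = ennreal m"
      unfolding img m_def using box measure_matrix_image[of "box (- t) t" B] S t
      by (simp add: img measure_def prod_nonneg)
    have P: "ennreal (P t) = (\<integral>\<^sup>+z. ennreal (gauss_density z) * indicator S z \<partial>lborel)"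
      unfolding P_def S_def[symmetric] gauss.emeasure_eq_measure[symmetric]
      by (subst gauss_eq_density, rule emeasure_density) measurable
    have K: "\<phi> * m = K * (\<Prod>i\<in>UNIV. t $ i)"
      by (simp add: K_def m_def \<phi>_def detB prod.distrib power_divide)
    have P0: "0 \<le> P t"
      by (simp add: P_def)
    have "ennreal (P t) \<le> (\<integral>\<^sup>+z. ennreal \<phi> * indicator S z \<partial>lborel)"
      unfolding P by (intro nn_integral_mono mult_right_mono ennreal_leI)
        (auto simp: gauss_density_def \<phi>_def)
    also have "\<dots> = ennreal (\<phi> * m)"
      using \<phi> m0 by (simp add: nn_integral_cmult_indicator vol ennreal_mult)
    finally have up: "P t \<le> \<phi> * m"
      using \<phi> m0 by simp
    let ?s = "1 - C * (\<Sum>i\<in>UNIV. (t $ i)\<^sup>2)"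
    have low: "\<phi> * m * ?s \<le> P t"
    proof (cases "0 \<le> ?s")
      case True
      have "ennreal (\<phi> * m * ?s) = ennreal (\<phi> * ?s) * ennreal m"
        using \<phi> m0 True by (simp add: ennreal_mult[symmetric] ac_simps)
      also have "\<dots> = (\<integral>\<^sup>+z. ennreal (\<phi> * ?s) * indicator S z \<partial>lborel)"
        by (simp add: nn_integral_cmult_indicator vol)
      also have "\<dots> \<le> ennreal (P t)"
        unfolding P
      proof (intro nn_integral_mono)
        fix z
        show "ennreal (\<phi> * ?s) * indicator S z \<le> ennreal (gauss_density z) * indicator S z"
        proof (cases "z \<in> S")
          case True
          have "(norm z)\<^sup>2 = (norm (B *v (W *v z)))\<^sup>2"
            by (simp add: matrix_vector_mul_assoc BW)
          also have "\<dots> \<le> (c * norm (W *v z))\<^sup>2"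
            using c by (intro power_mono) auto
          also have "\<dots> = c\<^sup>2 * (\<Sum>i\<in>UNIV. ((W *v z) $ i)\<^sup>2)"
            by (simp add: power_mult_distrib norm_vec_def L2_set_def sum_nonneg)
          also have "\<dots> \<le> c\<^sup>2 * (\<Sum>i\<in>UNIV. (t $ i)\<^sup>2)"
          proof (intro mult_left_mono sum_mono)
            fix i
            have "\<bar>(W *v z) $ i\<bar> \<le> t $ i"
              using True by (auto simp: S_def less_imp_le)
            then show "((W *v z) $ i)\<^sup>2 \<le> (t $ i)\<^sup>2"
              using abs_le_square_iff t[of i] by fastforce
          qed simp
          finally have "?s \<le> 1 + (- (norm z)\<^sup>2 / 2)"
            by (simp add: C_def)
          also have "\<dots> \<le> exp (- (norm z)\<^sup>2 / 2)"
            by (rule exp_ge_add_one_self)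
          finally have "\<phi> * ?s \<le> gauss_density z"
            using \<phi> by (simp add: gauss_density_def \<phi>_def)
          then show ?thesis
            by (intro mult_right_mono ennreal_leI) auto
        qed simp
      qed
      finally show ?thesis
        using P0 by (simp add: ennreal_le_iff)
    next
      case False
      then have "\<phi> * m * ?s \<le> 0"
        using \<phi> m0 by (intro mult_nonneg_nonpos) auto
      then show ?thesis
        using P0 by linarith
    qed
    show ?thesis
      using up low by (simp only: K)
  qed
  show ?thesis
    by (intro exI[of _ C] conjI allI impI bounds) (auto simp: C_def)
qed

section \<open>Estimates for the one-dimensional normal law\<close>

lemma std_normal_interval:
  assumes "0 \<le> t"
  shows "2 * t * std_normal_density t \<le> measure std_normal {x. \<bar>x\<bar> \<le> t}"
    and "measure std_normal {x. \<bar>x\<bar> \<le> t} \<le> 2 * t * std_normal_density 0"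
proof -
  have eq: "{x :: real. \<bar>x\<bar> \<le> t} = {- t..t}"
    by auto
  have P: "ennreal (measure std_normal {x. \<bar>x\<bar> \<le> t}) = (\<integral>\<^sup>+x. ennreal (std_normal_density x) * indicator {- t..t} x \<partial>lborel)"
    unfolding std_normal.emeasure_eq_measure[symmetric] eq by (rule emeasure_density) auto
  have const: "(\<integral>\<^sup>+x. ennreal d * indicator {- t..t} x \<partial>lborel) = ennreal (2 * t * d)" if "0 \<le> d" for d :: real
    using that assms by (simp add: nn_integral_cmult_indicator ennreal_mult[symmetric] ac_simps)
  have "ennreal (2 * t * std_normal_density t) \<le> ennreal (measure std_normal {x. \<bar>x\<bar> \<le> t})"
    unfolding P const[OF normal_density_nonneg, symmetric]
  proof (intro nn_integral_mono)
    fix x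
    show "ennreal (std_normal_density t) * indicator {- t..t} x \<le> ennreal (std_normal_density x) * indicator {- t..t} x"
    proof (cases "x \<in> {- t..t}")
      case True
      then have "x\<^sup>2 \<le> t\<^sup>2"
        by (auto intro: abs_le_square_iff[THEN iffD1])
      then show ?thesis
        by (auto simp: std_normal_density_def intro!: mult_right_mono ennreal_leI divide_right_mono)
    qed simp
  qed
  then show "2 * t * std_normal_density t \<le> measure std_normal {x. \<bar>x\<bar> \<le> t}"
    by (simp add: ennreal_le_iff)
  have "ennreal (measure std_normal {x. \<bar>x\<bar> \<le> t}) \<le> ennreal (2 * t * std_normal_density 0)"
    unfolding P const[OF normal_density_nonneg, symmetric]
    by (intro nn_integral_mono mult_right_mono ennreal_leI)
      (auto simp: std_normal_density_def intro!: divide_right_mono)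
  then show "measure std_normal {x. \<bar>x\<bar> \<le> t} \<le> 2 * t * std_normal_density 0"
    using assms by (subst (asm) ennreal_le_iff) auto
qed

lemma std_normal_interval_limit:
  "((\<lambda>t. measure std_normal {x. \<bar>x\<bar> \<le> t} / t) \<longlongrightarrow> 2 / sqrt (2 * pi)) (at_right 0)"
proof -
  have lower: "((\<lambda>t. 2 * std_normal_density t) \<longlongrightarrow> 2 * std_normal_density 0) (at_right 0)"
    unfolding std_normal_density_def by (intro tendsto_intros) auto
  have pos: "\<forall>\<^sub>F t in at_right 0. 0 < (t :: real)"
    by (simp add: eventually_at_right_less)
  have "((\<lambda>t. measure std_normal {x. \<bar>x\<bar> \<le> t} / t) \<longlongrightarrow> 2 * std_normal_density 0) (at_right 0)"
  proof (rule tendsto_sandwich[OF _ _ lower tendsto_const])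
    show "\<forall>\<^sub>F t in at_right 0. 2 * std_normal_density t \<le> measure std_normal {x. \<bar>x\<bar> \<le> t} / t"
      using pos
    proof eventually_elim
      case (elim t)
      then show ?case
        using std_normal_interval(1)[of t] by (simp add: pos_le_divide_eq ac_simps)
    qed
    show "\<forall>\<^sub>F t in at_right 0. measure std_normal {x. \<bar>x\<bar> \<le> t} / t \<le> 2 * std_normal_density 0"
      using pos
    proof eventually_elim
      case (elim t)
      then show ?case
        using std_normal_interval(2)[of t] by (simp add: pos_divide_le_eq ac_simps)
    qed
  qed
  then show ?thesis
    by (simp add: std_normal_density_def)
qed

lemma std_normal_no_atom: "measure std_normal {x. \<bar>x\<bar> = t} = 0"
proof -
  have "{x :: real. \<bar>x\<bar> = t} \<subseteq> {t, - t}"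
    by auto
  then have "finite {x :: real. \<bar>x\<bar> = t}"
    by (rule finite_subset) simp
  then have "{x :: real. \<bar>x\<bar> = t} \<in> null_sets lborel"
    by (rule finite_imp_null_set_lborel)
  then have "{x :: real. \<bar>x\<bar> = t} \<in> null_sets std_normal"
    using absolutely_continuousI_density[of "\<lambda>x. ennreal (std_normal_density x)" lborel]
    by (auto simp: absolutely_continuous_def)
  then show ?thesis
    by (simp add: measure_eq_0_null_sets)
qed

text \<open>Both half-lines are shifted to the origin. Dropping the nonnegative cross term of the
  square extracts the factor \<open>exp (- t\<^sup>2 / 2)\<close>, and the shifted half-lines
  together have mass at most 1, so no prefactor arises.\<close>

lemma std_normal_upper_tail:
  assumes "0 \<le> t"
  shows "measure std_normal {x. t < \<bar>x\<bar>} \<le> exp (- t\<^sup>2 / 2)"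
proof -
  let ?n = "\<lambda>x. ennreal (std_normal_density x)"
  let ?E = "exp (- t\<^sup>2 / 2)"
  have shift: "?n (s + x) \<le> ennreal ?E * ?n x" if "s\<^sup>2 = t\<^sup>2" "0 \<le> s * x" for s x
  proof -
    have "exp (- (s + x)\<^sup>2 / 2) \<le> exp (- t\<^sup>2 / 2 + - x\<^sup>2 / 2)"
      using that by (auto simp: power2_sum field_simps)
    also have "\<dots> = ?E * exp (- x\<^sup>2 / 2)"
      by (rule exp_add)
    finally show ?thesis
      by (auto simp: std_normal_density_def ennreal_mult[symmetric] divide_right_mono intro!: ennreal_leI)
  qed
  have "ennreal (measure std_normal {x. t < \<bar>x\<bar>}) = (\<integral>\<^sup>+x. ?n x * indicator {x. t < \<bar>x\<bar>} x \<partial>lborel)"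
    unfolding std_normal.emeasure_eq_measure[symmetric] by (rule emeasure_density) auto
  also have "\<dots> = (\<integral>\<^sup>+x. ?n x * indicator {t<..} x + ?n x * indicator {..<- t} x \<partial>lborel)"
    using assms by (intro nn_integral_cong) (auto simp: indicator_def)
  also have "\<dots> = (\<integral>\<^sup>+x. ?n x * indicator {t<..} x \<partial>lborel) + (\<integral>\<^sup>+x. ?n x * indicator {..<- t} x \<partial>lborel)"
    by (intro nn_integral_add) auto
  also have "(\<integral>\<^sup>+x. ?n x * indicator {t<..} x \<partial>lborel) = (\<integral>\<^sup>+x. ?n (t + 1 * x) * indicator {t<..} (t + 1 * x) \<partial>lborel)"
    by (subst nn_integral_real_affine[where c = 1 and t = t]) auto
  also have "(\<integral>\<^sup>+x. ?n x * indicator {..<- t} x \<partial>lborel) = (\<integral>\<^sup>+x. ?n (- t + 1 * x) * indicator {..<- t} (- t + 1 * x) \<partial>lborel)"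
    by (subst nn_integral_real_affine[where c = 1 and t = "- t"]) auto
  also have "(\<integral>\<^sup>+x. ?n (t + 1 * x) * indicator {t<..} (t + 1 * x) \<partial>lborel)
      + (\<integral>\<^sup>+x. ?n (- t + 1 * x) * indicator {..<- t} (- t + 1 * x) \<partial>lborel)
      \<le> (\<integral>\<^sup>+x. ennreal ?E * ?n x * indicator {0<..} x \<partial>lborel) + (\<integral>\<^sup>+x. ennreal ?E * ?n x * indicator {..<0} x \<partial>lborel)"
    using assms shift[of t] shift[of "- t"]
    by (intro add_mono nn_integral_mono) (auto simp: indicator_def mult_nonneg_nonpos)
  also have "\<dots> = (\<integral>\<^sup>+x. ennreal ?E * ?n x * indicator {0<..} x + ennreal ?E * ?n x * indicator {..<0} x \<partial>lborel)"
    by (intro nn_integral_add[symmetric]) auto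
  also have "\<dots> \<le> (\<integral>\<^sup>+x. ennreal ?E * ?n x \<partial>lborel)"
    by (intro nn_integral_mono) (auto simp: indicator_def)
  also have "\<dots> = ennreal ?E * emeasure std_normal (space std_normal)"
    by (simp add: nn_integral_cmult emeasure_density)
  also have "\<dots> = ennreal ?E"
    by (simp only: std_normal.emeasure_space_1 mult_1_right)
  finally show ?thesis
    by (simp add: ennreal_le_iff)
qed

text \<open>A prefactor above 1 would blow up in the \<open>a\<close>-th power of
  \<open>surv\<close>, so the bound has to be sharp at \<open>t = 0\<close>. Up to 1 it comes from
  the mass at least \<open>2 * t * std_normal_density 1\<close> of the interval of radius
  \<open>t\<close>; beyond 1 from \<open>t / 2 \<le> t\<^sup>2 / 2\<close>.\<close>

lemma std_normal_exp_tail: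
  assumes "0 \<le> t"
  shows "measure std_normal {x. t < \<bar>x\<bar>} \<le> exp (- min (2 * std_normal_density 1) (1 / 2) * t)"
proof (cases "t \<le> 1")
  case True
  have "measure std_normal {x. t < \<bar>x\<bar>} = measure std_normal (space std_normal - {x. \<bar>x\<bar> \<le> t})"
    by (intro arg_cong[where f = "measure std_normal"]) auto
  also have "\<dots> = 1 - measure std_normal {x. \<bar>x\<bar> \<le> t}"
    by (intro std_normal.prob_compl) simp
  also have "\<dots> \<le> 1 - 2 * t * std_normal_density t"
    using std_normal_interval(1)[OF assms] by simp
  also have "\<dots> \<le> 1 - 2 * t * std_normal_density 1"
  proof -
    have "t\<^sup>2 \<le> 1"
      using True assms by (simp add: power_le_one)
    then have "std_normal_density 1 \<le> std_normal_density t"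
      by (simp add: std_normal_density_def divide_right_mono)
    then show ?thesis
      using assms by (simp add: mult_left_mono)
  qed
  also have "\<dots> \<le> 1 + - min (2 * std_normal_density 1) (1 / 2) * t"
    using mult_right_mono[OF min.cobounded1[of "2 * std_normal_density 1" "1 / 2"] assms] by (simp add: ac_simps)
  also have "\<dots> \<le> exp (- min (2 * std_normal_density 1) (1 / 2) * t)"
    by (rule exp_ge_add_one_self)
  finally show ?thesis .
next
  case False
  have "measure std_normal {x. t < \<bar>x\<bar>} \<le> exp (- t\<^sup>2 / 2)"
    by (rule std_normal_upper_tail[OF assms])
  also have "min (2 * std_normal_density 1) (1 / 2) * t \<le> t * t / 2"
    using False mult_right_mono[OF min.cobounded2[of "2 * std_normal_density 1" "1 / 2"] assms]
      mult_right_mono[of 1 t t] by simp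
  then have "exp (- t\<^sup>2 / 2) \<le> exp (- min (2 * std_normal_density 1) (1 / 2) * t)"
    by (simp add: power2_eq_square)
  finally show ?thesis .
qed

section \<open>Law of the vector of projections\<close>

lemma distr_gauss_component: "distr gauss borel (\<lambda>x :: real ^ 'n. x $ i) = std_normal"
proof -
  have "distr gauss borel (\<lambda>x :: real ^ 'n. x $ i) = distr (PiM (UNIV :: 'n set) (\<lambda>_. std_normal)) borel ((\<lambda>x. x $ i) \<circ> (\<lambda>f. \<chi> i. f i))"
    unfolding gauss_def by (intro distr_distr) auto
  also have "\<dots> = distr (PiM (UNIV :: 'n set) (\<lambda>_. std_normal)) std_normal (\<lambda>f. f i)"
    by (intro distr_cong) auto
  also have "\<dots> = std_normal"
    by (intro distr_PiM_component std_normal.prob_space_axioms) auto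
  finally show ?thesis .
qed

lemma distr_gauss_inner:
  fixes u :: "real ^ 'd"
  assumes "norm u = 1"
  shows "distr gauss borel (\<lambda>r. r \<bullet> u) = std_normal"
proof -
  \<comment> \<open>The embedding of the line spanned by \<open>u\<close>; the claim is the
    one-dimensional case of \<open>distr_gauss_isometry\<close>.\<close>
  define T :: "real ^ 1 \<Rightarrow> real ^ 'd" where "T x = (x $ 1) *\<^sub>R u" for x
  have T: "linear T" "\<And>x. norm (T x) = norm x"
    using assms by (auto simp: T_def norm_real scaleR_add_left intro!: linearI)
  let ?z = "\<lambda>r. (\<chi> j. r \<bullet> T (axis j 1)) :: real ^ 1"
  have "T (axis 1 1) = u"
    by (simp add: T_def)
  then have "distr gauss borel (\<lambda>r. r \<bullet> u) = distr gauss borel ((\<lambda>x. x $ 1) \<circ> ?z)"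
    by (simp add: comp_def)
  also have "\<dots> = distr (distr gauss borel ?z) borel (\<lambda>x. x $ 1)"
    by (intro distr_distr[symmetric] measurable_vec_lambda) measurable
  also have "\<dots> = std_normal"
    by (simp only: distr_gauss_isometry[OF T] distr_gauss_component)
  finally show ?thesis .
qed

definition projections :: "('k \<Rightarrow> real ^ 'd) \<Rightarrow> real ^ 'd \<Rightarrow> real ^ 'k" where
  "projections v r = (\<chi> i. r \<bullet> v i)"

lemma measurable_projections [measurable]: "projections v \<in> borel_measurable borel"
  unfolding projections_def[abs_def] by (intro measurable_vec_lambda) measurable

text \<open>The rows of \<open>W\<close> are the vectors \<open>v i\<close> in the coordinates of their span.\<close>

lemma gram_coordinates:
  fixes v :: "'k::finite \<Rightarrow> real ^ 'd"
  assumes v: "inj v" "independent (range v)"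
  obtains W B :: "real ^ 'k ^ 'k"
    where "B ** W = mat 1" "parallelepiped_volume v = absdet W"
      "distr gauss borel (projections v) = distr gauss borel ((*v) W)"
proof -
  define T :: "real ^ 'k \<Rightarrow> real ^ 'd" where "T = (SOME T. spanning_isometry v T)"
  have "spanning_isometry v T"
    unfolding T_def using ex_spanning_isometry[OF v] by (rule someI_ex)
  then have T: "linear T" "\<And>x. norm (T x) = norm x" "range T = span (range v)"
    by (auto simp: spanning_isometry_def)
  have inner_T: "T x \<bullet> T y = x \<bullet> y" for x y
    by (simp add: dot_norm T(2) flip: linear_add[OF T(1)])
  have inj_T: "x = y" if "T x = T y" for x y
    using that T(2)[of "x - y"] by (simp add: linear_diff[OF T(1)])
  have "\<forall>i. \<exists>w. T w = v i"
    using T(3) by (metis (no_types, lifting) image_iff rangeI span_base)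
  then obtain w where w: "\<And>i. T (w i) = v i"
    by metis
  define W :: "real ^ 'k ^ 'k" where "W = (\<chi> i. w i)"
  have W: "(W *v z) $ i = w i \<bullet> z" for z i
    by (simp add: W_def matrix_vector_mul_component)
  \<comment> \<open>Invertibility of \<open>W\<close>: \<open>T z\<close> would be orthogonal to
    every \<open>v i\<close> while lying in their span.\<close>
  have "z = 0" if "W *v z = 0" for z
  proof -
    have "v i \<bullet> T z = 0" for i
      using that W[of z i] by (simp add: inner_T flip: w)
    then have "\<And>x. x \<in> range v \<Longrightarrow> orthogonal (T z) x"
      by (auto simp: orthogonal_def inner_commute)
    moreover have "T z \<in> span (range v)"
      unfolding T(3)[symmetric] by (rule rangeI)
    ultimately have "orthogonal (T z) (T z)"
      by (rule orthogonal_to_span[rotated])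
    then have "norm (T z) = 0"
      by (simp add: orthogonal_def)
    then show "z = 0"
      by (simp add: T(2))
  qed
  then obtain B where BW: "B ** W = mat 1"
    using matrix_left_invertible_ker[of W] by blast
  have "parallelepiped_volume v = absdet W"
  proof -
    have sum: "T (transpose W *v t) = (\<Sum>i\<in>UNIV. t $ i *\<^sub>R v i)" for t
    proof -
      have "transpose W *v t = (\<Sum>i\<in>UNIV. t $ i *\<^sub>R w i)"
        by (simp add: matrix_mult_sum column_def transpose_def W_def scalar_mult_eq_scaleR vec_eq_iff)
      then show ?thesis
        by (simp add: linear_sum[OF T(1)] linear_scale[OF T(1)] w)
    qed
    \<comment> \<open>In the coordinates of the span, the parallelepiped is the image of the unit
      cube under the matrix with columns \<open>w i\<close>. The isometry \<open>T\<close> is the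
      very choice made in \<open>parallelepiped_volume\<close>.\<close>
    have "T -` parallelepiped v = (*v) (transpose W) ` cbox 0 1"
    proof (intro equalityI subsetI)
      fix x assume "x \<in> T -` parallelepiped v"
      then obtain t where t: "\<forall>i. 0 \<le> t i \<and> t i \<le> 1" "T x = (\<Sum>i\<in>UNIV. t i *\<^sub>R v i)"
        by (auto simp: parallelepiped_def)
      then have "T x = T (transpose W *v (\<chi> i. t i))"
        by (simp only: sum vec_lambda_beta)
      then have "x = transpose W *v (\<chi> i. t i)"
        by (rule inj_T)
      moreover have "(\<chi> i. t i) \<in> cbox 0 1"
        using t by (simp add: mem_box_cart)
      ultimately show "x \<in> (*v) (transpose W) ` cbox 0 1"
        by blast
    next
      fix x assume "x \<in> (*v) (transpose W) ` cbox 0 1"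
      then obtain t where t: "t \<in> cbox 0 1" "x = transpose W *v t"
        by blast
      have "T x = (\<Sum>i\<in>UNIV. t $ i *\<^sub>R v i)"
        unfolding t(2) by (rule sum)
      then show "x \<in> T -` parallelepiped v"
        using t(1) by (auto simp: parallelepiped_def mem_box_cart intro!: exI[of _ "($) t"])
    qed
    moreover have "compact ((*v) (transpose W) ` cbox 0 1)"
      by (intro compact_continuous_image linear_continuous_on compact_cbox)
        (simp add: linear_conv_bounded_linear[symmetric])
    then have img: "(*v) (transpose W) ` cbox 0 1 \<in> sets borel"
      by (rule borel_compact)
    moreover have unit: "emeasure lborel (cbox 0 1 :: (real ^ 'k) set) = 1"
    proof -
      have "emeasure lborel (cbox 0 1 :: (real ^ 'k) set) = (\<Prod>b\<in>Basis. ((1 - 0) :: real ^ 'k) \<bullet> b)"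
        by (rule emeasure_lborel_cbox) (auto simp: Basis_vec_def inner_axis)
      then show ?thesis
        by (simp only: prod_Basis_vec inner_axis_right) simp
    qed
    then have "emeasure lborel ((*v) (transpose W) ` cbox 0 1) = ennreal (absdet W)"
      using measure_matrix_image[OF _ _ img] by (simp add: absdet_transpose measure_def)
    ultimately show ?thesis
      unfolding parallelepiped_volume_def T_def[symmetric] by (simp add: measure_def absdet_nonneg)
  qed
  moreover have "distr gauss borel (projections v) = distr gauss borel ((*v) W)"
  proof -
    let ?z = "\<lambda>r. (\<chi> j. r \<bullet> T (axis j 1)) :: real ^ 'k"
    \<comment> \<open>\<open>?z r\<close> holds the coordinates of the orthogonal projection of
      \<open>r\<close> on the span; it is standard Gaussian by
      \<open>distr_gauss_isometry\<close>.\<close>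
    have "projections v r = W *v ?z r" for r
    proof -
      have "r \<bullet> v i = w i \<bullet> ?z r" for i
      proof -
        have "w i = (\<Sum>j\<in>UNIV. w i $ j *\<^sub>R axis j 1)"
          using basis_expansion[of "w i"] by (simp add: scalar_mult_eq_scaleR)
        then have "v i = (\<Sum>j\<in>UNIV. w i $ j *\<^sub>R T (axis j 1))"
          using linear_sum[OF T(1)] linear_scale[OF T(1)] w[of i] by (metis (no_types, lifting) sum.cong)
        then have "r \<bullet> v i = (\<Sum>j\<in>UNIV. w i $ j * (r \<bullet> T (axis j 1)))"
          by (simp add: inner_sum_right)
        also have "\<dots> = w i \<bullet> ?z r"
          by (simp add: inner_vec_def)
        finally show ?thesis .
      qed
      then show ?thesis
        by (simp add: vec_eq_iff projections_def W)
    qed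
    then have "distr gauss borel (projections v) = distr gauss borel ((*v) W \<circ> ?z)"
      by (simp add: comp_def projections_def[abs_def] fun_eq_iff)
    also have "\<dots> = distr (distr gauss borel ?z) borel ((*v) W)"
    proof (intro distr_distr[symmetric])
      show "(*v) W \<in> measurable borel borel"
        by (intro linear_borel_measurable) simp
      show "?z \<in> measurable gauss borel"
        by (intro measurable_vec_lambda) measurable
    qed
    finally show ?thesis
      by (simp only: distr_gauss_isometry[OF T(1,2)])
  qed
  ultimately show ?thesis
    using BW that by blast
qed

lemma parallelepiped_volume_pos:
  fixes v :: "'k::finite \<Rightarrow> real ^ 'd"
  assumes v: "inj v" "independent (range v)"
  shows "0 < parallelepiped_volume v"
proof -
  obtain W B :: "real ^ 'k ^ 'k" where "B ** W = mat 1" "parallelepiped_volume v = absdet W"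
    using gram_coordinates[OF v] by metis
  moreover from this have "absdet B * absdet W = 1"
    using absdet_mult[of B W] by (simp add: absdet_mat_1)
  then have "absdet W \<noteq> 0"
    by auto
  ultimately show ?thesis
    using absdet_nonneg[of W] by simp
qed

lemma measure_distr_projections:
  assumes "Measurable.pred borel P"
  shows "measure (distr gauss borel (projections v)) {x. P x} = measure gauss {r. P (projections v r)}"
  using assms by (subst measure_distr) (auto simp: pred_def vimage_def)

lemma projections_box_bounds:
  fixes v :: "'k::finite \<Rightarrow> real ^ 'd"
  assumes v: "inj v" "independent (range v)"
  defines "K \<equiv> (2 / sqrt (2 * pi)) ^ CARD('k) / parallelepiped_volume v"
    and "P \<equiv> \<lambda>t. measure (distr gauss borel (projections v)) {x. \<forall>i. \<bar>x $ i\<bar> < t $ i}"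
  shows "\<exists>C\<ge>0. \<forall>t. (\<forall>i. 0 \<le> t $ i) \<longrightarrow>
    K * (\<Prod>i\<in>UNIV. t $ i) * (1 - C * (\<Sum>i\<in>UNIV. (t $ i)\<^sup>2)) \<le> P t \<and> P t \<le> K * (\<Prod>i\<in>UNIV. t $ i)"
proof -
  obtain W B :: "real ^ 'k ^ 'k" where BW: "B ** W = mat 1" and vol: "parallelepiped_volume v = absdet W"
    and distr: "distr gauss borel (projections v) = distr gauss borel ((*v) W)"
    using gram_coordinates[OF v] by metis
  have [measurable]: "(*v) W \<in> borel_measurable borel"
    by (intro linear_borel_measurable) simp
  have "P t = measure gauss {z. \<forall>i. \<bar>(W *v z) $ i\<bar> < t $ i}" for t
  proof -
    have "{x \<in> space borel. \<forall>i. \<bar>x $ i\<bar> < t $ i} \<in> sets borel"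
      by measurable
    then show ?thesis
      unfolding P_def distr by (subst measure_distr) (auto simp: vimage_def)
  qed
  then show ?thesis
    using gauss_box_bounds[OF BW] by (simp add: K_def vol)
qed

text \<open>The upper box bound for the independent family of just \<open>v i\<close> and
  \<open>v j\<close> makes the probability \<open>O(t^2)\<close>.\<close>

lemma projections_pair_limit:
  fixes v :: "'k::finite \<Rightarrow> real ^ 'd"
  assumes v: "inj v" "independent (range v)" and "i \<noteq> j"
  shows "((\<lambda>t. measure (distr gauss borel (projections v)) {x. \<bar>x $ i\<bar> \<le> t \<and> \<bar>x $ j\<bar> \<le> t} / t) \<longlongrightarrow> 0) (at_right 0)"
proof -
  \<comment> \<open>The box bound takes a family indexed by a finite type; \<open>bool\<close>
    indexes the pair.\<close>
  define u where "u b = (if b then v i else v j)" for b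
  have u: "inj u" "independent (range u)"
  proof -
    show "inj u"
      using \<open>i \<noteq> j\<close> inj_eq[OF v(1)] by (intro injI) (simp add: u_def split: if_splits)
    show "independent (range u)"
      by (rule independent_mono[OF v(2)]) (auto simp: u_def)
  qed
  define K where "K = (2 / sqrt (2 * pi)) ^ CARD(bool) / parallelepiped_volume u"
  have K: "measure (distr gauss borel (projections u)) {x. \<forall>i. \<bar>x $ i\<bar> < t $ i} \<le> K * (\<Prod>i\<in>UNIV. t $ i)"
    if "\<And>i. 0 \<le> t $ i" for t
    unfolding K_def using projections_box_bounds[OF u] that by blast
  have bound: "measure (distr gauss borel (projections v)) {x. \<bar>x $ i\<bar> \<le> t \<and> \<bar>x $ j\<bar> \<le> t} / t \<le> 4 * K * t" if "0 < t" for t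
  proof -
    have "measure (distr gauss borel (projections v)) {x. \<bar>x $ i\<bar> \<le> t \<and> \<bar>x $ j\<bar> \<le> t}
        = measure gauss {r. \<bar>r \<bullet> v i\<bar> \<le> t \<and> \<bar>r \<bullet> v j\<bar> \<le> t}"
      by (subst measure_distr_projections) (auto simp: projections_def)
    \<comment> \<open>The doubled threshold turns the weak inequalities into the strict ones of the
      box.\<close>
    also have "\<dots> \<le> measure gauss {r. \<forall>b. \<bar>projections u r $ b\<bar> < (\<chi> b. 2 * t) $ b}"
    proof (rule gauss.finite_measure_mono)
      have "{r \<in> space borel. \<forall>b. \<bar>projections u r $ b\<bar> < (\<chi> b. 2 * t) $ b} \<in> sets borel"
        by measurable
      then show "{r. \<forall>b. \<bar>projections u r $ b\<bar> < (\<chi> b. 2 * t) $ b} \<in> sets gauss"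
        by simp
    qed (use that in \<open>auto simp: projections_def u_def\<close>)
    also have "\<dots> = measure (distr gauss borel (projections u)) {x. \<forall>b. \<bar>x $ b\<bar> < (\<chi> b. 2 * t) $ b}"
      by (rule measure_distr_projections[symmetric]) measurable
    also have "\<dots> \<le> K * (\<Prod>b\<in>(UNIV :: bool set). (\<chi> b. 2 * t) $ b)"
      using that by (intro K) simp
    also have "\<dots> = 4 * K * t * t"
      by (simp add: UNIV_bool)
    finally show ?thesis
      using that by (simp add: pos_divide_le_eq)
  qed
  have lim: "((\<lambda>t. 4 * K * t) \<longlongrightarrow> 0) (at_right 0)"
    by (rule tendsto_eq_intros refl | simp)+
  show ?thesis
  proof (rule tendsto_sandwich[OF _ _ tendsto_const lim])
    have pos: "\<forall>\<^sub>F t in at_right 0. 0 < (t :: real)"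
      by (simp add: eventually_at_right_less)
    show "\<forall>\<^sub>F t in at_right 0. 0 \<le> measure (distr gauss borel (projections v)) {x. \<bar>x $ i\<bar> \<le> t \<and> \<bar>x $ j\<bar> \<le> t} / t"
      using pos by eventually_elim simp
    show "\<forall>\<^sub>F t in at_right 0. measure (distr gauss borel (projections v)) {x. \<bar>x $ i\<bar> \<le> t \<and> \<bar>x $ j\<bar> \<le> t} / t \<le> 4 * K * t"
      using pos by eventually_elim (rule bound)
  qed
qed

lemma projection_law_projections:
  fixes v :: "'k::finite \<Rightarrow> real ^ 'd"
  assumes v: "inj v" "independent (range v)" "\<And>i. norm (v i) = 1"
  shows "\<exists>C. projection_law (distr gauss borel (projections v)) (2 / sqrt (2 * pi))
    (min (2 * std_normal_density 1) (1 / 2)) ((2 / sqrt (2 * pi)) ^ CARD('k) / parallelepiped_volume v) C"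
proof -
  let ?N = "distr gauss borel (projections v)"
  let ?K = "(2 / sqrt (2 * pi)) ^ CARD('k) / parallelepiped_volume v"
  obtain C where C0: "0 \<le> C" and C: "\<forall>t. (\<forall>i. 0 \<le> t $ i) \<longrightarrow>
      ?K * (\<Prod>i\<in>UNIV. t $ i) * (1 - C * (\<Sum>i\<in>UNIV. (t $ i)\<^sup>2)) \<le> measure ?N {x. \<forall>i. \<bar>x $ i\<bar> < t $ i}
      \<and> measure ?N {x. \<forall>i. \<bar>x $ i\<bar> < t $ i} \<le> ?K * (\<Prod>i\<in>UNIV. t $ i)"
    using projections_box_bounds[OF v(1,2)] by blast
  \<comment> \<open>Each \<open>v i\<close> is a unit vector, so each component of the law is
    standard normal and conditions on one component reduce to the one-dimensional estimates.\<close>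
  have marg: "measure ?N {x. P (x $ i)} = measure std_normal {s. P s}" if [measurable]: "Measurable.pred borel P" for P i
  proof -
    have "{s. P s} \<in> sets borel"
      using that by (simp add: pred_def)
    then have "measure std_normal {s. P s} = measure gauss {r. P (r \<bullet> v i)}"
      unfolding distr_gauss_inner[OF v(3)[of i], symmetric] by (subst measure_distr) (auto simp: vimage_def)
    moreover have "measure ?N {x. P (x $ i)} = measure gauss {r. P (projections v r $ i)}"
      by (rule measure_distr_projections) measurable
    ultimately show ?thesis
      by (simp add: projections_def)
  qed
  have interval: "measure ?N {x. \<bar>x $ i\<bar> \<le> t} = measure std_normal {s. \<bar>s\<bar> \<le> t}" for i t
    by (rule marg[of "\<lambda>s. \<bar>s\<bar> \<le> t"]) measurable
  have upper: "measure ?N {x. t < \<bar>x $ i\<bar>} = measure std_normal {s. t < \<bar>s\<bar>}" for i t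
    by (rule marg[of "\<lambda>s. t < \<bar>s\<bar>"]) measurable
  have atom: "measure ?N {x. \<bar>x $ i\<bar> = t} = measure std_normal {s. \<bar>s\<bar> = t}" for i t
    by (rule marg[of "\<lambda>s. \<bar>s\<bar> = t"]) measurable
  have "projection_law ?N (2 / sqrt (2 * pi)) (min (2 * std_normal_density 1) (1 / 2))
      ((2 / sqrt (2 * pi)) ^ CARD('k) / parallelepiped_volume v) C"
  proof (intro projection_law.intro projection_law_axioms.intro)
    show "prob_space ?N"
      by (intro gauss.prob_space_distr) simp
    show "((\<lambda>t. measure ?N {x. \<bar>x $ i\<bar> \<le> t} / t) \<longlongrightarrow> 2 / sqrt (2 * pi)) (at_right 0)" for i
      unfolding interval by (rule std_normal_interval_limit)
    show "((\<lambda>t. measure ?N {x. \<bar>x $ i\<bar> \<le> t \<and> \<bar>x $ j\<bar> \<le> t} / t) \<longlongrightarrow> 0) (at_right 0)" if "i \<noteq> j" for i j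
      by (rule projections_pair_limit[OF v(1,2) that])
    show "measure ?N {x. t < \<bar>x $ i\<bar>} \<le> exp (- min (2 * std_normal_density 1) (1 / 2) * t)" if "0 \<le> t" for i t
      unfolding upper by (rule std_normal_exp_tail[OF that])
    show "measure ?N {x. \<bar>x $ i\<bar> = t} = 0" for i t
      unfolding atom by (rule std_normal_no_atom)
    show "0 < min (2 * std_normal_density 1) (1 / 2)"
      by (simp add: normal_density_pos)
    show "0 < (2 / sqrt (2 * pi)) ^ CARD('k) / parallelepiped_volume v"
      using parallelepiped_volume_pos[OF v(1,2)] by simp
    show "?K * (\<Prod>i\<in>UNIV. t $ i) * (1 - C * (\<Sum>i\<in>UNIV. (t $ i)\<^sup>2)) \<le> measure ?N {x. \<forall>i. \<bar>x $ i\<bar> < t $ i}"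
      "measure ?N {x. \<forall>i. \<bar>x $ i\<bar> < t $ i} \<le> ?K * (\<Prod>i\<in>UNIV. t $ i)"
      if "\<And>i. 0 \<le> t $ i" for t
      using C that by blast+
  qed (use C0 in auto)
  then show ?thesis ..
qed

section \<open>From the projection law to the random vectors of the hash\<close>

theorem theorem3:
  fixes v :: "'k::finite \<Rightarrow> real ^ 'd"
    and b :: nat
    and M :: "nat \<Rightarrow> 'm measure"
    and R :: "nat \<Rightarrow> nat \<Rightarrow> 'm \<Rightarrow> real ^ 'd"
  assumes "inj v" and "independent (range v)" and "\<And>i. norm (v i) = 1"
    and "\<And>a. prob_space (M a)"
    and "\<And>a. prob_space.indep_vars (M a) (\<lambda>_. borel) (R a) {1..a + b}"
    and "\<And>a n. n \<in> {1..a + b} \<Longrightarrow>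
           prob_space.indep_vars (M a) (\<lambda>_. borel) (\<lambda>c \<omega>. R a n \<omega> $ c) UNIV"
    and "\<And>a n c. n \<in> {1..a + b} \<Longrightarrow>
           distributed (M a) lborel (\<lambda>\<omega>. R a n \<omega> $ c) std_normal_density"
  shows "(\<lambda>a. measure (M a) {\<omega> \<in> space (M a).
                \<forall>i j. random_projection_hash a b (\<lambda>n. R a n \<omega>) (v i) =
                      random_projection_hash a b (\<lambda>n. R a n \<omega>) (v j)})
         \<sim>[at_top]
         (\<lambda>a. parallelepiped_volume v powi (- int b) *
              real ((a + b) choose b) powi (- int CARD('k) + 1))"
proof -
  let ?N = "distr gauss borel (projections v)"
  obtain C where "projection_law ?N (2 / sqrt (2 * pi)) (min (2 * std_normal_density 1) (1 / 2))
      ((2 / sqrt (2 * pi)) ^ CARD('k) / parallelepiped_volume v) C"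
    using projection_law_projections[OF assms(1-3)] by blast
  then interpret N: projection_law ?N "2 / sqrt (2 * pi)" "min (2 * std_normal_density 1) (1 / 2)"
    "(2 / sqrt (2 * pi)) ^ CARD('k) / parallelepiped_volume v" C .
  have prob: "measure (M a) {\<omega> \<in> space (M a).
                \<forall>i j. random_projection_hash a b (\<lambda>n. R a n \<omega>) (v i) =
                      random_projection_hash a b (\<lambda>n. R a n \<omega>) (v j)}
      = measure (PiM {1..a + b} (\<lambda>_. ?N)) {x \<in> space (PiM {1..a + b} (\<lambda>_. ?N)). N.collision a b x}"
    if "0 < a" for a
  proof -
    interpret M: prob_space "M a"
      by (rule assms(4))
    let ?S = "{1..a + b}"
    let ?P = "PiM ?S (\<lambda>_. ?N)"
    let ?Y = "\<lambda>n \<omega>. projections v (R a n \<omega>)"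
    \<comment> \<open>\<open>M.indep_vars_iff_distr_eq_PiM'\<close> asks for a nonempty index set.
      Assuming \<open>0 < a\<close> also covers \<open>b = 0\<close>, and a single value of
      \<open>a\<close> does not matter for the asymptotics.\<close>
    have ne: "?S \<noteq> {}"
      using that by simp
    have R [measurable]: "R a n \<in> borel_measurable (M a)" if "n \<in> ?S" for n
      using assms(5)[of a] that by (auto simp: M.indep_vars_def)
    have Y: "?Y n \<in> borel_measurable (M a)" if "n \<in> ?S" for n
      using R[OF that] by measurable
    have "M.indep_vars (\<lambda>_. borel) ?Y ?S"
      using M.indep_vars_compose2[OF assms(5)[of a], of "\<lambda>_. projections v" "\<lambda>_. borel"] by simp
    then have "distr (M a) (\<Pi>\<^sub>M n\<in>?S. borel) (\<lambda>\<omega>. \<lambda>n\<in>?S. ?Y n \<omega>) = (\<Pi>\<^sub>M n\<in>?S. distr (M a) borel (?Y n))"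
      using M.indep_vars_iff_distr_eq_PiM'[OF ne, of ?Y "\<lambda>_. borel"] Y by simp
    also have "\<dots> = ?P"
    proof (rule PiM_cong[OF refl])
      fix n assume n: "n \<in> ?S"
      have "distr (M a) borel (?Y n) = distr (distr (M a) borel (R a n)) borel (projections v)"
        using R[OF n] by (subst distr_distr) (auto simp: comp_def)
      also have "distr (M a) borel (R a n) = gauss"
        using n by (intro distr_eq_gaussI assms)
      finally show "distr (M a) borel (?Y n) = ?N" .
    qed
    finally have D: "distr (M a) ?P (\<lambda>\<omega>. \<lambda>n\<in>?S. ?Y n \<omega>) = ?P"
      by (simp cong: distr_cong sets_PiM_cong)
    have meas: "(\<lambda>\<omega>. \<lambda>n\<in>?S. ?Y n \<omega>) \<in> measurable (M a) ?P"
      using Y by (intro measurable_restrict) simp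
    \<comment> \<open>The hash only looks at indices in \<open>?S\<close>, so it does not see the
      restriction that brings the projections into the product space.\<close>
    have coll: "N.collision a b (\<lambda>n\<in>?S. ?Y n \<omega>) \<longleftrightarrow>
       (\<forall>i j. random_projection_hash a b (\<lambda>n. R a n \<omega>) (v i) = random_projection_hash a b (\<lambda>n. R a n \<omega>) (v j))" for \<omega>
    proof -
      have "random_projection_hash a b (\<lambda>n\<in>?S. ?Y n \<omega>) (axis i 1) = random_projection_hash a b (\<lambda>n. R a n \<omega>) (v i)" for i
        by (rule random_projection_hash_cong) (simp add: inner_axis_right projections_def)
      then show ?thesis
        by (simp only: N.collision_def)
    qed
    have "measure ?P {x \<in> space ?P. N.collision a b x}
        = measure (distr (M a) ?P (\<lambda>\<omega>. \<lambda>n\<in>?S. ?Y n \<omega>)) {x \<in> space ?P. N.collision a b x}"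
      by (simp only: D)
    also have "\<dots> = measure (M a) ((\<lambda>\<omega>. \<lambda>n\<in>?S. ?Y n \<omega>) -` {x \<in> space ?P. N.collision a b x} \<inter> space (M a))"
      by (rule measure_distr[OF meas]) measurable
    also have "(\<lambda>\<omega>. \<lambda>n\<in>?S. ?Y n \<omega>) -` {x \<in> space ?P. N.collision a b x} \<inter> space (M a)
        = {\<omega> \<in> space (M a). N.collision a b (\<lambda>n\<in>?S. ?Y n \<omega>)}"
      using measurable_space[OF meas] by blast
    finally show ?thesis
      by (simp only: coll)
  qed
  \<comment> \<open>The Gaussian constants in \<open>K / c ^ k\<close> cancel and leave the
    reciprocal of the volume.\<close>
  have vol: "(2 / sqrt (2 * pi)) ^ CARD('k) / parallelepiped_volume v / (2 / sqrt (2 * pi)) ^ CARD('k)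
      = inverse (parallelepiped_volume v)"
  proof -
    have *: "x / y / x = inverse y" if "x \<noteq> 0" for x y :: real
      using that by (simp add: divide_inverse)
    show ?thesis
      by (rule *) simp
  qed
  have "(\<lambda>a. measure (PiM {1..a + b} (\<lambda>_. ?N)) {x \<in> space (PiM {1..a + b} (\<lambda>_. ?N)). N.collision a b x})
      \<sim>[at_top] (\<lambda>a. parallelepiped_volume v powi (- int b) * real ((a + b) choose b) powi (- int CARD('k) + 1))"
    using N.collision_prob_asymp[of b] unfolding vol by (simp add: power_int_minus power_inverse)
  then show ?thesis
    by (rule asymp_equiv_cong[THEN iffD1, rotated -1])
      (auto intro: eventually_mono[OF eventually_gt_at_top[of 0]] simp: prob)
qed

end
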